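(* Let $A$ be a generalized Cartan matrix with associated data $\mathfrak h_{\mathbb R}^*,\Pi,W,\overline C$, let $\mu\in\overline C$, and let $H$ be the convex hull of $W\mu$. The following are equivalent: (a) $(\Pi^*\cap J_0)^0=\Pi^*\cap J_0$. (b) There are only finitely many edges of $H$ that contain the vertex $\mu$. In particular, if the Kac-Moody algebra $\mathfrak g(A)$ is of finite, affine, or strongly hyperbolic type, then there are only finitely many edges of $H$ which contain the vertex $\mu$.
   Context: Let $A=(a_{ij})_{i,j=1}^m$ be a generalized Cartan matrix (integral, $a_{ii}=2$, $a_{ij}\le 0$ for $i\ne j$, $a_{ij}=0\Rightarrow a_{ji}=0$) of rank $l$. Let $(\mathfrak h_{\mathbb R},\Pi,\Pi^\vee)$ be a realization of $A$ over $\mathbb R$: $\mathfrak h_{\mathbb R}$ is a real vector space of dimension $2m-l$, and $\Pi=\{\alpha_1,\dots,\alpha_m\}\subset\mathfrak h_{\mathbb R}^*$ and $\Pi^\vee=\{\alpha_1^\vee,\dots,\alpha_m^\vee\}\subset\mathfrak h_{\mathbb R}$ are linearly independent with $\langle\alpha_j,\alpha_i^\vee\rangle=a_{ij}$. The Weyl group $W\subset GL(\mathfrak h_{\mathbb R}^* )$ is generated by the reflections $r_{\alpha_i}(\eta)=\eta-\langle\eta,\alpha_i^\vee\rangle\alpha_i$. The fundamental chamber is $\overline C=\{\eta\in\mathfrak h_{\mathbb R}^*\mid\langle\eta,\alpha^\vee\rangle\ge 0\ \forall\alpha\in\Pi\}$. Set $J_0=\{\alpha\in\Pi\mid\langle\mu,\alpha^\vee\rangle=0\}$.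 Connected components of a subset of $\Pi$ are taken in the Dynkin diagram of $A$ (distinct $\alpha,\beta\in\Pi$ are adjacent iff $\langle\alpha,\beta^\vee\rangle\ne 0$). A subset $I\subseteq\Pi$ is $\mu$-connected if no connected component of $I$ is contained in $J_0$ (the empty set is $\mu$-connected). $\Pi^*$ is the biggest $\mu$-connected subset of $\Pi$, i.e. the union of the connected components of $\Pi$ not contained in $J_0$. For $K\subseteq\Pi$, $K^0$ is the union of those connected components of $K$ whose generalized Cartan submatrix is of finite type ($\emptyset^0=\emptyset$). A face of the convex set $H$ is a convex subset $F\subseteq H$ such that every closed line segment in $H$ having a relative interior point in $F$ has both endpoints in $F$. A vertex is a zero-dimensional face, an edge is a one-dimensional face; $\{\mu\}$ is a vertex of $H$. The finite/affine/indefinite classification is the standard one (Kac) for Kac-Moody algebras $\mathfrak g(A)$ with indecomposable $A$; $\mathfrak g(A)$ is of strongly hyperbolic type if it is of indefinite type and every proper nonempty indecomposable generalized Cartan submatrix of $A$ is of finite type. *)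

theory Defs
  imports "HOL-Analysis.Analysis"
begin

text \<open>
  The index type \<open>'n\<close> stands for \<open>{1,\<dots>,m}\<close> and \<open>A $ i $ j\<close> for \<open>a\<^sub>i\<^sub>j\<close>.
  The real vector space \<open>\<hh>\<close> is a type \<open>'h\<close> of class \<open>euclidean_space\<close>, of which only the
  finite-dimensional vector space structure is used; its dual is \<open>'h \<Rightarrow>\<^sub>L real\<close>, where
  boundedness is automatic in finite dimension.
  Subsets of \<open>\<Pi>\<close> are given by their index sets.
\<close>

definition gen_cartan :: "real^'n^'n \<Rightarrow> bool" where
  "gen_cartan A \<longleftrightarrow>
     (\<forall>i j. A $ i $ j \<in> \<int>) \<and> (\<forall>i. A $ i $ i = 2) \<and>
     (\<forall>i j. i \<noteq> j \<longrightarrow> A $ i $ j \<le> 0) \<and> (\<forall>i j. A $ i $ j = 0 \<longrightarrow> A $ j $ i = 0)"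

definition realization ::
  "real^'n^'n \<Rightarrow> ('n \<Rightarrow> ('h::euclidean_space) \<Rightarrow>\<^sub>L real) \<Rightarrow> ('n \<Rightarrow> 'h) \<Rightarrow> bool" where
  "realization A \<alpha> \<alpha>v \<longleftrightarrow>
     DIM('h) = 2 * CARD('n) - rank A \<and>
     inj \<alpha> \<and> independent (range \<alpha>) \<and> inj \<alpha>v \<and> independent (range \<alpha>v) \<and>
     (\<forall>i j. blinfun_apply (\<alpha> j) (\<alpha>v i) = A $ i $ j)"

definition simple_refl ::
  "('n \<Rightarrow> ('h::euclidean_space) \<Rightarrow>\<^sub>L real) \<Rightarrow> ('n \<Rightarrow> 'h) \<Rightarrow> 'n \<Rightarrow> ('h \<Rightarrow>\<^sub>L real) \<Rightarrow> ('h \<Rightarrow>\<^sub>L real)" where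
  "simple_refl \<alpha> \<alpha>v i \<eta> = \<eta> - blinfun_apply \<eta> (\<alpha>v i) *\<^sub>R \<alpha> i"

inductive_set weyl_group ::
  "('n \<Rightarrow> ('h::euclidean_space) \<Rightarrow>\<^sub>L real) \<Rightarrow> ('n \<Rightarrow> 'h) \<Rightarrow> (('h \<Rightarrow>\<^sub>L real) \<Rightarrow> ('h \<Rightarrow>\<^sub>L real)) set"
  for \<alpha> \<alpha>v where
  one: "id \<in> weyl_group \<alpha> \<alpha>v"
| refl: "simple_refl \<alpha> \<alpha>v i \<in> weyl_group \<alpha> \<alpha>v"
| inverse: "w \<in> weyl_group \<alpha> \<alpha>v \<Longrightarrow> inv w \<in> weyl_group \<alpha> \<alpha>v"
| mult: "w \<in> weyl_group \<alpha> \<alpha>v \<Longrightarrow> w' \<in> weyl_group \<alpha> \<alpha>v \<Longrightarrow> w \<circ> w' \<in> weyl_group \<alpha> \<alpha>v"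

definition fund_chamber :: "('n \<Rightarrow> 'h::euclidean_space) \<Rightarrow> ('h \<Rightarrow>\<^sub>L real) set" where
  "fund_chamber \<alpha>v = {\<eta>. \<forall>i. blinfun_apply \<eta> (\<alpha>v i) \<ge> 0}"

definition orbit_hull ::
  "('n \<Rightarrow> ('h::euclidean_space) \<Rightarrow>\<^sub>L real) \<Rightarrow> ('n \<Rightarrow> 'h) \<Rightarrow> ('h \<Rightarrow>\<^sub>L real) \<Rightarrow> ('h \<Rightarrow>\<^sub>L real) set" where
  "orbit_hull \<alpha> \<alpha>v \<mu> = convex hull ((\<lambda>w. w \<mu>) ` weyl_group \<alpha> \<alpha>v)"

definition J0 :: "('n \<Rightarrow> 'h::euclidean_space) \<Rightarrow> ('h \<Rightarrow>\<^sub>L real) \<Rightarrow> 'n set" where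
  "J0 \<alpha>v \<mu> = {i. blinfun_apply \<mu> (\<alpha>v i) = 0}"

text \<open>
  The library's \<open>edge_of\<close> and \<open>aff_dim\<close> require class \<open>euclidean_space\<close>, which the dual does not
  instantiate. The dimension of a nonempty convex set is that of the linear span of its differences.
\<close>

definition edge_in :: "'a::real_vector set \<Rightarrow> 'a set \<Rightarrow> bool" where
  "edge_in E S \<longleftrightarrow> E face_of S \<and> E \<noteq> {} \<and> dim {x - y | x y. x \<in> E \<and> y \<in> E} = 1"

subsection \<open>Dynkin diagram\<close>

text \<open>The index order in \<open>A $ j $ i\<close> comes from \<open>\<langle>\<alpha>\<^sub>i, \<alpha>\<^sub>j\<^sup>\<or>\<rangle> = a\<^sub>j\<^sub>i\<close>.\<close>

definition dynkin :: "real^'n^'n \<Rightarrow> ('n \<times> 'n) set" where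
  "dynkin A = {(i, j). i \<noteq> j \<and> A $ j $ i \<noteq> 0}"

definition conn_comps :: "real^'n^'n \<Rightarrow> 'n set \<Rightarrow> 'n set set" where
  "conn_comps A K = {{j. (i, j) \<in> (Restr (dynkin A) K)\<^sup>*} | i. i \<in> K}"

definition mu_connected :: "real^'n^'n \<Rightarrow> 'n set \<Rightarrow> 'n set \<Rightarrow> bool" where
  "mu_connected A J I \<longleftrightarrow> (\<forall>C \<in> conn_comps A I. \<not> C \<subseteq> J)"

definition Pi_star :: "real^'n^'n \<Rightarrow> 'n set \<Rightarrow> 'n set" where
  "Pi_star A J = \<Union>{C \<in> conn_comps A UNIV. \<not> C \<subseteq> J}"

subsection \<open>Finite, affine and indefinite type\<close>

text \<open>
  The principal submatrix \<open>A\<^sub>K\<close>, completed by an identity block outside \<open>K\<close>. The result has the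
  same determinant and the same corank as \<open>A\<^sub>K\<close>.
\<close>

definition principal :: "real^'n^'n \<Rightarrow> 'n set \<Rightarrow> real^'n^'n" where
  "principal A K =
     (\<chi> i j. if i \<in> K \<and> j \<in> K then A $ i $ j else if i = j then 1 else 0)"

text \<open>Entry \<open>i\<close> of \<open>A\<^sub>K v\<close>, for \<open>i \<in> K\<close>; values of \<open>v\<close> outside \<open>K\<close> are irrelevant.\<close>

definition sub_mult :: "real^'n^'n \<Rightarrow> 'n set \<Rightarrow> ('n \<Rightarrow> real) \<Rightarrow> 'n \<Rightarrow> real" where
  "sub_mult A K v i = (\<Sum>j\<in>K. A $ i $ j * v j)"

definition indecomposable :: "real^'n^'n \<Rightarrow> 'n set \<Rightarrow> bool" where
  "indecomposable A K \<longleftrightarrow> K \<noteq> {} \<and>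
     \<not> (\<exists>I J. I \<noteq> {} \<and> J \<noteq> {} \<and> I \<inter> J = {} \<and> I \<union> J = K \<and>
            (\<forall>i\<in>I. \<forall>j\<in>J. A $ i $ j = 0 \<and> A $ j $ i = 0))"

text \<open>
  The cases (Fin), (Aff), (Ind) in the classification theorem of Kac, \<^emph>\<open>Infinite dimensional Lie
  algebras\<close>, Theorem 4.3. The type of the Kac-Moody algebra is, by definition, that of its matrix.
\<close>

definition finite_type :: "real^'n^'n \<Rightarrow> 'n set \<Rightarrow> bool" where
  "finite_type A K \<longleftrightarrow> indecomposable A K \<and>
     det (principal A K) \<noteq> 0 \<and>
     (\<exists>u. (\<forall>i\<in>K. u i > 0) \<and> (\<forall>i\<in>K. sub_mult A K u i > 0)) \<and>
     (\<forall>v. (\<forall>i\<in>K. sub_mult A K v i \<ge> 0) \<longrightarrow> (\<forall>i\<in>K. v i > 0) \<or> (\<forall>i\<in>K. v i = 0))"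

definition affine_type :: "real^'n^'n \<Rightarrow> 'n set \<Rightarrow> bool" where
  "affine_type A K \<longleftrightarrow> indecomposable A K \<and>
     CARD('n) - rank (principal A K) = 1 \<and>
     (\<exists>u. (\<forall>i\<in>K. u i > 0) \<and> (\<forall>i\<in>K. sub_mult A K u i = 0)) \<and>
     (\<forall>v. (\<forall>i\<in>K. sub_mult A K v i \<ge> 0) \<longrightarrow> (\<forall>i\<in>K. sub_mult A K v i = 0))"

definition indefinite_type :: "real^'n^'n \<Rightarrow> 'n set \<Rightarrow> bool" where
  "indefinite_type A K \<longleftrightarrow> indecomposable A K \<and>
     (\<exists>u. (\<forall>i\<in>K. u i > 0) \<and> (\<forall>i\<in>K. sub_mult A K u i < 0)) \<and>
     (\<forall>v. (\<forall>i\<in>K. sub_mult A K v i \<ge> 0) \<and> (\<forall>i\<in>K. v i \<ge> 0) \<longrightarrow> (\<forall>i\<in>K. v i = 0))"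

definition strongly_hyperbolic :: "real^'n^'n \<Rightarrow> bool" where
  "strongly_hyperbolic A \<longleftrightarrow> indefinite_type A UNIV \<and>
     (\<forall>K. K \<noteq> {} \<and> K \<subset> UNIV \<and> indecomposable A K \<longrightarrow> finite_type A K)"

text \<open>The set \<open>K\<^sup>0\<close>.\<close>

definition finite_part :: "real^'n^'n \<Rightarrow> 'n set \<Rightarrow> 'n set" where
  "finite_part A K = \<Union>{C \<in> conn_comps A K. finite_type A C}"

subsection \<open>\<open>Pi_star\<close> is the biggest \<open>\<mu>\<close>-connected set\<close>

lemma conn_comp_subset: "C \<in> conn_comps A K \<Longrightarrow> C \<subseteq> K"
  unfolding conn_comps_def by (auto elim: rtranclE)

lemma mu_connected_subset_Pi_star:
  assumes "mu_connected A J I" shows "I \<subseteq> Pi_star A J"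
proof
  fix i assume i: "i \<in> I"
  let ?C = "{j. (i, j) \<in> (Restr (dynkin A) I)\<^sup>*}"
  let ?D = "{j. (i, j) \<in> (Restr (dynkin A) UNIV)\<^sup>*}"
  have "?C \<in> conn_comps A I" using i unfolding conn_comps_def by blast
  then have "\<not> ?C \<subseteq> J" using assms unfolding mu_connected_def by blast
  moreover have "?C \<subseteq> ?D" using rtrancl_mono[of "Restr (dynkin A) I" "Restr (dynkin A) UNIV"] by auto
  ultimately have "\<not> ?D \<subseteq> J" by blast
  moreover have "?D \<in> conn_comps A UNIV" unfolding conn_comps_def by blast
  moreover have "i \<in> ?D" by simp
  ultimately show "i \<in> Pi_star A J" unfolding Pi_star_def by blast
qed

lemma Pi_star_mu_connected:
  assumes "gen_cartan A" shows "mu_connected A J (Pi_star A J)"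
  unfolding mu_connected_def
proof
  fix C assume "C \<in> conn_comps A (Pi_star A J)"
  then obtain i where i: "i \<in> Pi_star A J"
    and C: "C = {j. (i, j) \<in> (Restr (dynkin A) (Pi_star A J))\<^sup>*}"
    unfolding conn_comps_def by blast
  have sym: "sym (dynkin A)"
    using assms unfolding gen_cartan_def dynkin_def sym_def by auto
  from i obtain k where k: "(k, i) \<in> (dynkin A)\<^sup>*" "\<not> {j. (k, j) \<in> (dynkin A)\<^sup>*} \<subseteq> J"
    unfolding Pi_star_def conn_comps_def by auto
  have D: "{j. (i, j) \<in> (dynkin A)\<^sup>*} = {j. (k, j) \<in> (dynkin A)\<^sup>*}"
    using k(1) sym_rtrancl[OF sym] by (auto dest: symD intro: rtrancl_trans)
  have sub: "{j. (k, j) \<in> (dynkin A)\<^sup>*} \<subseteq> Pi_star A J"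
    using k(2) unfolding Pi_star_def conn_comps_def by auto
  have "(i, j) \<in> (Restr (dynkin A) (Pi_star A J))\<^sup>*" if "(i, j) \<in> (dynkin A)\<^sup>*" for j
    using that
  proof (induction rule: rtrancl_induct)
    case (step y z)
    then have "(i, z) \<in> (dynkin A)\<^sup>*" by auto
    then have "y \<in> Pi_star A J" "z \<in> Pi_star A J" using step.hyps D sub by blast+
    then show ?case using step by (auto intro: rtrancl_into_rtrancl)
  qed simp
  then show "\<not> C \<subseteq> J" using k(2) D C by blast
qed

end

theory Submission
  imports Defs
begin

text \<open>
  A dominant \<open>\<mu>\<close> satisfies \<open>\<mu> - w \<mu> \<ge> 0\<close> for all \<open>w\<close>, because real roots are sign coherent. So the
  functionals vanishing on one simple root \<open>\<alpha>\<^sub>j\<close>, \<open>j \<notin> J\<^sub>0\<close>, and positive on the others cut out edges: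
  \<open>H\<close> has an edge at \<open>\<mu>\<close> in direction \<open>- w \<alpha>\<^sub>j\<close> for every \<open>w \<in> W\<^bsub>J\<^sub>0\<^esub>\<close>. If there are finitely many edges,
  the orbit of \<open>\<alpha>\<^sub>j\<close> under \<open>W\<^bsub>J\<^sub>0\<^esub>\<close> is finite, and its sum is an invariant vector. The coefficients
  \<open>c \<ge> 0\<close> of this vector satisfy \<open>A\<^sub>C c \<ge> 0\<close> and \<open>A\<^sub>C c \<noteq> 0\<close> on each component \<open>C\<close> of \<open>J\<^sub>0\<close> adjacent to
  \<open>j\<close>, which characterizes finite type.

  Conversely, a matrix of finite type is symmetrizable and positive definite, so the orbits of integral
  vectors under the parabolic subgroup of \<open>\<Pi>\<^sup>* \<inter> J\<^sub>0\<close> are finite. By separation, \<open>H - \<mu>\<close> lies in the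
  cone generated by the finitely many vectors \<open>w r\<^sub>j \<mu> - \<mu>\<close>, and every edge at \<open>\<mu>\<close> contains one of the
  points \<open>w r\<^sub>j \<mu>\<close>.
\<close>

subsection \<open>Indecomposable matrices and components of the diagram\<close>

locale cartan_matrix =
  fixes A :: "real^'n^'n"
  assumes gcm: "gen_cartan A"
begin

lemma cartan_diag: "A $ i $ i = 2"
  and cartan_offdiag: "i \<noteq> j \<Longrightarrow> A $ i $ j \<le> 0"
  and cartan_Ints: "A $ i $ j \<in> \<int>"
  and cartan_zero: "A $ i $ j = 0 \<longleftrightarrow> A $ j $ i = 0"
  using gcm unfolding gen_cartan_def by (blast, blast, blast, metis)

lemma indecomposable_nonempty: "indecomposable A C \<Longrightarrow> C \<noteq> {}"
  by (simp add: indecomposable_def)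

text \<open>The zero pattern of \<open>A\<close> is symmetric, so a block \<open>Z\<close> whose
  rows vanish on \<open>C - Z\<close> splits \<open>C\<close>.\<close>

lemma indecomposable_closed:
  assumes "indecomposable A C" "Z \<subseteq> C" "Z \<noteq> {}" "\<And>i j. i \<in> Z \<Longrightarrow> j \<in> C - Z \<Longrightarrow> A $ i $ j = 0"
  shows "Z = C"
proof (rule ccontr)
  assume "Z \<noteq> C"
  then have "C - Z \<noteq> {}" using assms(2) by blast
  moreover have "Z \<inter> (C - Z) = {}" "Z \<union> (C - Z) = C" using assms(2) by auto
  moreover have "\<forall>i\<in>Z. \<forall>j\<in>C - Z. A $ i $ j = 0 \<and> A $ j $ i = 0" using assms(4) cartan_zero by metis
  ultimately have "\<exists>I J. I \<noteq> {} \<and> J \<noteq> {} \<and> I \<inter> J = {} \<and> I \<union> J = C \<and>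
      (\<forall>i\<in>I. \<forall>j\<in>J. A $ i $ j = 0 \<and> A $ j $ i = 0)"
    using assms(3) by (intro exI[of _ Z] exI[of _ "C - Z"] conjI)
  then show False using assms(1) by (simp add: indecomposable_def)
qed

text \<open>In a row where \<open>v\<close> vanishes only off-diagonal terms remain, all
  nonpositive. Their sum is nonnegative, so each is zero, and the zero set of \<open>v\<close> is
  closed in the diagram.\<close>

lemma nonneg_zero_imp_all_zero:
  assumes C: "indecomposable A C" and v: "\<And>i. i \<in> C \<Longrightarrow> v i \<ge> 0"
    and Av: "\<And>i. i \<in> C \<Longrightarrow> sub_mult A C v i \<ge> 0" and "i \<in> C" "v i = 0" "j \<in> C"
  shows "v j = 0"
proof -
  let ?Z = "{k \<in> C. v k = 0}"
  have "?Z = C"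
  proof (rule indecomposable_closed[OF C])
    fix p q assume pq: "p \<in> ?Z" "q \<in> C - ?Z"
    have nonpos: "A $ p $ k * v k \<le> 0" if "k \<in> C" for k
      using pq v[OF that] cartan_offdiag[of p k] by (cases "k = p") (auto simp: mult_nonpos_nonneg)
    have "(\<Sum>k\<in>C. A $ p $ k * v k) \<ge> 0" using Av[of p] pq by (simp add: sub_mult_def)
    moreover have "(\<Sum>k\<in>C. A $ p $ k * v k) \<le> 0" using nonpos by (rule sum_nonpos)
    ultimately have "(\<Sum>k\<in>C. - (A $ p $ k * v k)) = 0" by (simp add: sum_negf)
    moreover have "\<And>k. k \<in> C \<Longrightarrow> - (A $ p $ k * v k) \<ge> 0" using nonpos by simp
    ultimately have "- (A $ p $ q * v q) = 0" using pq sum_nonneg_eq_0_iff[of C "\<lambda>k. - (A $ p $ k * v k)"] by auto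
    then show "A $ p $ q = 0" using pq by simp
  qed (use assms in auto)
  then show ?thesis using \<open>j \<in> C\<close> by blast
qed

section \<open>A criterion for finite type\<close>

lemma principal_mult:
  "(principal A K *v x) $ i = (if i \<in> K then sub_mult A K (\<lambda>j. x $ j) i else x $ i)"
proof (cases "i \<in> K")
  case True
  have "(principal A K *v x) $ i = (\<Sum>j\<in>UNIV. if j \<in> K then A $ i $ j * x $ j else 0)"
    unfolding matrix_vector_mult_def principal_def by (auto simp: True intro!: sum.cong)
  then show ?thesis using True by (simp add: sub_mult_def sum.If_cases)
next
  case False
  have "(principal A K *v x) $ i = (\<Sum>j\<in>UNIV. if i = j then x $ j else 0)"
    unfolding matrix_vector_mult_def principal_def vec_lambda_beta
    by (rule sum.cong) (auto simp: False)
  then show ?thesis using False by simp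
qed

text \<open>A zero of \<open>c\<close> would spread over all of \<open>C\<close>, so
  \<open>c\<close> is positive and arbitrary vectors can be compared with it.\<close>

lemma finite_typeI:
  assumes C: "indecomposable A C" and c: "\<And>i. i \<in> C \<Longrightarrow> c i \<ge> 0"
    and Ac: "\<And>i. i \<in> C \<Longrightarrow> sub_mult A C c i \<ge> 0" and k: "k \<in> C" "sub_mult A C c k > 0"
  shows "finite_type A C"
proof -
  have cpos: "c i > 0" if "i \<in> C" for i
  proof (rule ccontr)
    assume "\<not> c i > 0"
    then have "c i = 0" using c[OF that] by simp
    then have "c j = 0" if "j \<in> C" for j
      using nonneg_zero_imp_all_zero[OF C c Ac \<open>i \<in> C\<close> _ that] by blast
    then show False using k(2) by (simp add: sub_mult_def)
  qed
  have main: "(\<forall>i\<in>C. v i > 0) \<or> (\<forall>i\<in>C. v i = 0)" if v: "\<And>i. i \<in> C \<Longrightarrow> sub_mult A C v i \<ge> 0" for v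
  proof -
    \<comment> \<open>The least ratio makes \<open>v - t c\<close> nonnegative with a zero at the
      minimizing index \<open>m\<close>.\<close>
    define t where "t = Min ((\<lambda>i. v i / c i) ` C)"
    have fin: "finite ((\<lambda>i. v i / c i) ` C)" "(\<lambda>i. v i / c i) ` C \<noteq> {}" using k by auto
    obtain m where m: "m \<in> C" "t = v m / c m" using Min_in[OF fin] unfolding t_def by blast
    have ge: "v i - t * c i \<ge> 0" if "i \<in> C" for i
    proof -
      have "t \<le> v i / c i" unfolding t_def using fin that by (intro Min_le) auto
      then show ?thesis using cpos[OF that] by (simp add: field_simps)
    qed
    have lin: "sub_mult A C (\<lambda>i. v i - t * c i) i = sub_mult A C v i - t * sub_mult A C c i" for i
      by (simp add: sub_mult_def sum_subtractf sum_distrib_left algebra_simps)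
    show ?thesis
    proof (cases "t < 0")
      case True
      \<comment> \<open>For negative \<open>t\<close> the vector \<open>v - t c\<close> also has
        nonnegative image, so its zero at \<open>m\<close> spreads. Then \<open>A v = t A c\<close>
        is negative at \<open>k\<close>.\<close>
      have "v i - t * c i = 0" if "i \<in> C" for i
      proof (rule nonneg_zero_imp_all_zero[OF C ge _ m(1) _ that])
        fix i assume "i \<in> C"
        then show "sub_mult A C (\<lambda>i. v i - t * c i) i \<ge> 0"
          unfolding lin using v[of i] Ac[of i] True by (smt (verit) mult_nonneg_nonpos2 mult.commute)
      next
        show "v m - t * c m = 0" using m cpos[OF m(1)] by simp
      qed
      then have "sub_mult A C (\<lambda>i. v i - t * c i) k = 0" by (simp add: sub_mult_def)
      then have "sub_mult A C v k = t * sub_mult A C c k" by (simp add: lin)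
      then have "sub_mult A C v k < 0" using True k(2) by (simp add: mult_neg_pos)
      then show ?thesis using v[OF k(1)] by simp
    next
      case False
      have nn: "v i \<ge> 0" if "i \<in> C" for i
      proof -
        have "t * c i \<ge> 0" using False cpos[OF that] by simp
        then show ?thesis using ge[OF that] by linarith
      qed
      then show ?thesis using nonneg_zero_imp_all_zero[OF C nn v] by (metis less_eq_real_def)
    qed
  qed
  \<comment> \<open>The dichotomy for both \<open>x\<close> and \<open>- x\<close> makes the kernel
    trivial.\<close>
  have "x = 0" if x: "principal A C *v x = 0" for x
  proof -
    have Ax: "sub_mult A C (\<lambda>j. x $ j) i = 0" if "i \<in> C" for i
      using principal_mult[of C x i] x that by simp
    then have "sub_mult A C (\<lambda>j. - x $ j) i = 0" if "i \<in> C" for i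
      using that by (simp add: sub_mult_def sum_negf)
    then have "\<forall>i\<in>C. x $ i = 0" using main[of "\<lambda>j. x $ j"] main[of "\<lambda>j. - x $ j"] Ax k(1)
      by (smt (verit))
    moreover have "x $ i = 0" if "i \<notin> C" for i using principal_mult[of C x i] x that by simp
    ultimately show ?thesis by (auto simp: vec_eq_iff)
  qed
  then have inv: "invertible (principal A C)"
    using matrix_left_invertible_ker invertible_left_inverse by blast
  then obtain B where "principal A C ** B = mat 1" using invertible_right_inverse by blast
  \<comment> \<open>The image of \<open>c\<close> is known to be positive only at \<open>k\<close>;
    solving for the all-ones vector gives an image positive in every row of
    \<open>C\<close>.\<close>
  then have "principal A C *v (B *v 1) = 1" by (metis matrix_vector_mul_assoc matrix_vector_mul_lid)
  then obtain x where x: "principal A C *v x = 1" by blast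
  then have x1: "sub_mult A C (\<lambda>j. x $ j) i = 1" if "i \<in> C" for i
    using principal_mult[of C x i] that by simp
  then have "sub_mult A C (\<lambda>j. x $ j) k = 1" using k by blast
  then have "\<not> (\<forall>i\<in>C. x $ i = 0)" by (force simp: sub_mult_def intro: sum.neutral)
  then have "\<forall>i\<in>C. x $ i > 0" using main[of "\<lambda>j. x $ j"] x1 by auto
  then show ?thesis
    unfolding finite_type_def using C inv main x1 invertible_det_nz by (metis zero_less_one)
qed

section \<open>Connected components and the set \<open>Pi_star\<close>\<close>

lemma sym_Restr_dynkin: "sym ((Restr (dynkin A) K)\<^sup>*)"
  by (rule sym_rtrancl) (auto simp: sym_def dynkin_def, (metis cartan_zero)+)

lemma conn_comp_eq:
  assumes "C \<in> conn_comps A K" "i \<in> C"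
  shows "C = {j. (i, j) \<in> (Restr (dynkin A) K)\<^sup>*}"
proof -
  obtain k where k: "C = {j. (k, j) \<in> (Restr (dynkin A) K)\<^sup>*}"
    using assms(1) unfolding conn_comps_def by blast
  then show ?thesis using assms(2) sym_Restr_dynkin[of K]
    by (auto dest: symD intro: rtrancl_trans)
qed

lemma conn_comp_exists: "i \<in> K \<Longrightarrow> \<exists>C \<in> conn_comps A K. i \<in> C"
  unfolding conn_comps_def by blast

lemma conn_comp_nonempty: "C \<in> conn_comps A K \<Longrightarrow> C \<noteq> {}"
  unfolding conn_comps_def by blast

lemma conn_comp_closed:
  assumes "C \<in> conn_comps A K" "i \<in> C" "j \<in> K" "A $ i $ j \<noteq> 0"
  shows "j \<in> C"
proof (cases "i = j")
  case False
  then have "(i, j) \<in> Restr (dynkin A) K"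
    using assms conn_comp_subset[OF assms(1)] cartan_zero[of i j] by (auto simp: dynkin_def)
  then show ?thesis using conn_comp_eq[OF assms(1,2)] by blast
qed (use assms in simp)

lemma conn_comp_indecomposable:
  assumes "C \<in> conn_comps A K"
  shows "indecomposable A C"
  unfolding indecomposable_def
proof (intro conjI notI)
  show "C = {} \<Longrightarrow> False" using conn_comp_nonempty[OF assms] by simp
next
  assume "\<exists>I J. I \<noteq> {} \<and> J \<noteq> {} \<and> I \<inter> J = {} \<and> I \<union> J = C \<and>
            (\<forall>i\<in>I. \<forall>j\<in>J. A $ i $ j = 0 \<and> A $ j $ i = 0)"
  then obtain I J where IJ: "I \<noteq> {}" "J \<noteq> {}" "I \<inter> J = {}" "I \<union> J = C"
    "\<And>i j. i \<in> I \<Longrightarrow> j \<in> J \<Longrightarrow> A $ i $ j = 0 \<and> A $ j $ i = 0" by blast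
  obtain i where i: "i \<in> I" using IJ(1) by blast
  then have C: "C = {j. (i, j) \<in> (Restr (dynkin A) K)\<^sup>*}" using conn_comp_eq[OF assms] IJ by blast
  have "j \<in> I" if "(i, j) \<in> (Restr (dynkin A) K)\<^sup>*" for j
    using that
  proof (induction rule: rtrancl_induct)
    case (step y z)
    then have "(i, z) \<in> (Restr (dynkin A) K)\<^sup>*" by (meson rtrancl_into_rtrancl)
    then have "z \<in> I \<union> J" using C IJ(4) by blast
    moreover have "A $ z $ y \<noteq> 0" using step(2) by (auto simp: dynkin_def)
    ultimately show ?case using IJ(5) step.IH by blast
  qed (rule i)
  then show False using C IJ by blast
qed

lemma Pi_star_closed:
  assumes "i \<in> Pi_star A J" "A $ i $ j \<noteq> 0" shows "j \<in> Pi_star A J"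
  using assms conn_comp_closed unfolding Pi_star_def by blast

lemma Pi_star_outside: "i \<notin> J \<Longrightarrow> i \<in> Pi_star A J"
  using conn_comp_exists[of i UNIV] unfolding Pi_star_def by blast

text \<open>Without a neighbour outside \<open>J\<close>, the component \<open>C\<close> would
  absorb the whole diagram component \<open>D\<close> through \<open>i\<close>, but \<open>D\<close>
  is not contained in \<open>J\<close>.\<close>

lemma comp_has_outer_neighbour:
  assumes C: "C \<in> conn_comps A (Pi_star A J \<inter> J)"
  obtains i j where "i \<in> C" "j \<notin> J" "A $ i $ j \<noteq> 0"
proof (rule ccontr)
  assume none: "\<not> thesis"
  obtain i where i: "i \<in> C" using conn_comp_nonempty[OF C] by blast
  then have "i \<in> Pi_star A J" using conn_comp_subset[OF C] by blast
  then obtain D where D: "D \<in> conn_comps A UNIV" "\<not> D \<subseteq> J" "i \<in> D" unfolding Pi_star_def by blast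
  have "C \<inter> D = D"
  proof (rule indecomposable_closed[OF conn_comp_indecomposable[OF D(1)]])
    fix p q assume pq: "p \<in> C \<inter> D" "q \<in> D - C \<inter> D"
    show "A $ p $ q = 0"
    proof (rule ccontr)
      assume nz: "A $ p $ q \<noteq> 0"
      then have "q \<in> J" using none that pq by blast
      moreover have "q \<in> Pi_star A J" using Pi_star_closed[OF _ nz] conn_comp_subset[OF C] pq by blast
      ultimately have "q \<in> C" using conn_comp_closed[OF C _ _ nz] pq by blast
      then show False using pq by blast
    qed
  qed (use i D in auto)
  then show False using D(2) conn_comp_subset[OF C] by blast
qed

text \<open>Components are disjoint, so a finite type component containing an index of
  \<open>C\<close> must be \<open>C\<close> itself.\<close>

lemma finite_part_eq_iff: "finite_part A K = K \<longleftrightarrow> (\<forall>C \<in> conn_comps A K. finite_type A C)"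
proof
  assume eq: "finite_part A K = K"
  show "\<forall>C \<in> conn_comps A K. finite_type A C"
  proof
    fix C assume C: "C \<in> conn_comps A K"
    then obtain i where i: "i \<in> C" using conn_comp_nonempty by blast
    then have "i \<in> finite_part A K" using eq conn_comp_subset[OF C] by blast
    then obtain D where "D \<in> conn_comps A K" "finite_type A D" "i \<in> D" unfolding finite_part_def by blast
    then show "finite_type A C" using conn_comp_eq[OF C i] conn_comp_eq[of D K i] by simp
  qed
next
  assume "\<forall>C \<in> conn_comps A K. finite_type A C"
  then have "finite_part A K = \<Union>(conn_comps A K)" unfolding finite_part_def by auto
  also have "\<dots> = K"
    using conn_comp_exists[of _ K] conn_comp_subset[of _ A K] by (simp only: set_eq_iff Union_iff subset_iff) metis
  finally show "finite_part A K = K" .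
qed

lemma sub_mult_conn_comp:
  assumes "C \<in> conn_comps A K" "i \<in> C"
  shows "sub_mult A K v i = sub_mult A C v i"
  unfolding sub_mult_def
proof (rule sum.mono_neutral_right)
  show "\<forall>j\<in>K - C. A $ i $ j * v j = 0"
  proof
    fix j assume "j \<in> K - C"
    then have "A $ i $ j = 0" using conn_comp_closed[OF assms, of j] by auto
    then show "A $ i $ j * v j = 0" by simp
  qed
qed (use conn_comp_subset[OF assms(1)] in auto)

subsection \<open>Matrices of finite type are symmetrizable\<close>

text \<open>The two terms are negative with product \<open>A $ i $ j * A $ j $ i\<close>, which
  integrality makes at least 1; the inequality of arithmetic and geometric means bounds their
  sum.\<close>

lemma edge_weight:
  assumes "i \<noteq> j" "A $ i $ j \<noteq> 0" "u i > 0" "u j > 0"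
  shows "A $ i $ j * u j / u i + A $ j $ i * u i / u j \<le> -2"
proof -
  let ?x = "- (A $ i $ j * u j / u i)" and ?y = "- (A $ j $ i * u i / u j)"
  have neg: "A $ i $ j < 0" "A $ j $ i < 0"
    using assms cartan_offdiag[of i j] cartan_offdiag[of j i] cartan_zero[of i j] by (auto simp: less_le)
  then have "\<bar>A $ i $ j\<bar> \<ge> 1" "\<bar>A $ j $ i\<bar> \<ge> 1"
    using Ints_nonzero_abs_ge1[OF cartan_Ints] by (metis less_irrefl)+
  then have "A $ i $ j * A $ j $ i \<ge> 1" using neg
    by (smt (verit) mult_le_cancel_left1 mult_minus_left mult_minus_right)
  moreover have "?x * ?y = A $ i $ j * A $ j $ i" using assms by (simp add: field_simps)
  ultimately have "?x * ?y \<ge> 1" by simp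
  moreover have "(?x + ?y)\<^sup>2 = (?x - ?y)\<^sup>2 + 4 * (?x * ?y)" by (simp add: power2_eq_square algebra_simps)
  ultimately have "(?x + ?y)\<^sup>2 \<ge> 2\<^sup>2" using zero_le_power2[of "?x - ?y"] by (simp only: power2_eq_square)
  moreover have "?x \<ge> 0" "?y \<ge> 0"
    using neg assms by (auto intro!: divide_nonpos_pos mult_nonpos_nonneg simp del: divide_le_0_iff)
  then have "?x + ?y \<ge> 0" by simp
  ultimately have "2 \<le> ?x + ?y" using power2_le_imp_le by blast
  then show ?thesis by linarith
qed

text \<open>
  The form \<open>T K = (\<Sum>i\<in>K. \<Sum>j\<in>K. a\<^sub>i\<^sub>j u\<^sub>j / u\<^sub>i)\<close> is positive on nonempty sets. If \<open>K\<close> is grown one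
  adjacent vertex at a time, each new edge lowers \<open>T\<close> by at least 2 and each vertex raises it by 2;
  so every new vertex has exactly one edge to \<open>K\<close>, and the symmetrizer extends.
\<close>

lemma finite_type_symmetrizable:
  assumes ft: "finite_type A C"
  obtains d :: "'n \<Rightarrow> real" where "\<And>i. i \<in> C \<Longrightarrow> d i > 0"
    "\<And>i j. i \<in> C \<Longrightarrow> j \<in> C \<Longrightarrow> d i * A $ i $ j = d j * A $ j $ i"
proof -
  have ind: "indecomposable A C" using ft by (simp add: finite_type_def)
  obtain u where u: "\<And>i. i \<in> C \<Longrightarrow> u i > 0" and Au: "\<And>i. i \<in> C \<Longrightarrow> sub_mult A C u i > 0"
    using ft unfolding finite_type_def by blast
  define T where "T K = (\<Sum>i\<in>K. \<Sum>j\<in>K. A $ i $ j * u j / u i)" for K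
  have T_pos: "T K > 0" if K: "K \<subseteq> C" "K \<noteq> {}" for K
    unfolding T_def
  proof (rule sum_pos)
    fix i assume i: "i \<in> K"
    then have iC: "i \<in> C" using K by blast
    have "(\<Sum>j\<in>C. A $ i $ j * u j / u i) \<le> (\<Sum>j\<in>K. A $ i $ j * u j / u i)"
    proof -
      have "(\<Sum>j\<in>C - K. A $ i $ j * u j / u i) \<le> 0"
        using i u[OF iC] u
        by (intro sum_nonpos divide_nonpos_pos mult_nonpos_nonneg cartan_offdiag) (auto simp: less_imp_le)
      then show ?thesis using sum.subset_diff[OF K(1), of "\<lambda>j. A $ i $ j * u j / u i"] by simp
    qed
    moreover have "(\<Sum>j\<in>C. A $ i $ j * u j / u i) = sub_mult A C u i / u i"
      by (simp add: sub_mult_def sum_divide_distrib)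
    ultimately show "(\<Sum>j\<in>K. A $ i $ j * u j / u i) > 0" using Au[OF iC] u[OF iC] by (smt (verit) divide_pos_pos)
  qed (use K in auto)
  have step: "\<exists>K d. K \<subseteq> C \<and> card K = n \<and> T K \<le> 2 \<and> (\<forall>i\<in>K. d i > 0) \<and>
      (\<forall>i\<in>K. \<forall>j\<in>K. d i * A $ i $ j = d j * A $ j $ i)"
    if "1 \<le> n" "n \<le> card C" for n
    using that
  proof (induction n rule: nat_induct_at_least)
    case base
    obtain i where i: "i \<in> C" using indecomposable_nonempty[OF ind] by blast
    show ?case
      by (rule exI[of _ "{i}"], rule exI[of _ "\<lambda>_. 1"]) (use i u[OF i] in \<open>auto simp: T_def cartan_diag\<close>)
  next
    case (Suc n)
    then obtain K d where K: "K \<subseteq> C" "card K = n" "T K \<le> 2" and d: "\<And>i. i \<in> K \<Longrightarrow> d i > (0::real)"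
      and ds: "\<And>i j. i \<in> K \<Longrightarrow> j \<in> K \<Longrightarrow> d i * A $ i $ j = d j * A $ j $ i" by force
    have "K \<noteq> C" "K \<noteq> {}" using K Suc by auto
    then obtain p k where p: "p \<in> K" and k: "k \<in> C" "k \<notin> K" and pk: "A $ p $ k \<noteq> 0"
      using indecomposable_closed[OF ind K(1)] by blast
    define g where "g q = A $ q $ k * u k / u q + A $ k $ q * u q / u k" for q
    have T_ins: "T (insert k K) = T K + 2 + (\<Sum>q\<in>K. g q)"
      using k u[OF k(1)] by (simp add: T_def g_def sum.distrib cartan_diag)
    have g0: "g q \<le> 0" if "q \<in> K" for q
      using that k K(1) u cartan_offdiag[of q k] cartan_offdiag[of k q] unfolding g_def
      by (intro add_nonpos_nonpos divide_nonpos_pos mult_nonpos_nonneg) (auto simp: less_imp_le)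
    have g2: "g q \<le> -2" if "q \<in> K" "A $ q $ k \<noteq> 0" for q
      unfolding g_def using edge_weight[of q k] that k K(1) u by blast
    \<comment> \<open>A second edge at \<open>k\<close> would lower the form to at most 2 + 2 - 4 =
      0, against \<open>T_pos\<close>.\<close>
    have only: "A $ q $ k = 0" if q: "q \<in> K" "q \<noteq> p" for q
    proof (rule ccontr)
      assume "A $ q $ k \<noteq> 0"
      then have "g q + g p \<le> -4" using g2[OF q(1)] g2[OF p pk] by linarith
      moreover have "(\<Sum>r\<in>K. g r) = (\<Sum>r\<in>K - {p, q}. g r) + (\<Sum>r\<in>{p, q}. g r)"
        using p q by (intro sum.subset_diff) auto
      moreover have "(\<Sum>r\<in>K - {p, q}. g r) \<le> 0" using g0 by (intro sum_nonpos) auto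
      ultimately have "T (insert k K) \<le> 0" using T_ins K(3) q by simp
      then show False using T_pos[of "insert k K"] k K(1) by simp
    qed
    have "(\<Sum>q\<in>K. g q) = g p + (\<Sum>q\<in>K - {p}. g q)" using p by (intro sum.remove) auto
    moreover have "(\<Sum>q\<in>K - {p}. g q) \<le> 0" using g0 by (intro sum_nonpos) auto
    ultimately have T2: "T (insert k K) \<le> 2" using T_ins K(3) g2[OF p pk] by linarith
    \<comment> \<open>The value at \<open>k\<close> is forced by symmetry along the edge to
      \<open>p\<close>, the only edge from \<open>k\<close> into \<open>K\<close>.\<close>
    define d' where "d' = d(k := d p * A $ p $ k / A $ k $ p)"
    have kp: "A $ k $ p \<noteq> 0" using pk cartan_zero by metis
    have neg: "A $ p $ k < 0" "A $ k $ p < 0"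
      using pk kp p k cartan_offdiag[of p k] cartan_offdiag[of k p] by (auto simp: less_le)
    have dk: "d' k > 0" "d' k * A $ k $ p = d p * A $ p $ k"
      using d[OF p] neg by (simp_all add: d'_def divide_neg_neg mult_pos_neg)
    have dK: "d' q = d q" if "q \<in> K" for q using that k by (auto simp: d'_def)
    have edge: "d' k * A $ k $ q = d' q * A $ q $ k" if "q \<in> K" for q
      using dk(2) only[OF that] cartan_zero[of q k] dK[OF that] by (cases "q = p") auto
    have "\<forall>i\<in>insert k K. \<forall>j\<in>insert k K. d' i * A $ i $ j = d' j * A $ j $ i"
      using edge ds dK by (metis insert_iff)
    moreover have "\<forall>i\<in>insert k K. d' i > 0" using dk d dK by auto
    moreover have "card (insert k K) = Suc n" "insert k K \<subseteq> C" using k K by auto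
    ultimately show ?case using T2 by blast
  qed
  have "C \<noteq> {}" using indecomposable_nonempty[OF ind] .
  then have "1 \<le> card C" by (simp add: Suc_le_eq card_gt_0_iff)
  from step[OF this order_refl] obtain K d where "K \<subseteq> C" "card K = card C" and d: "\<forall>i\<in>K. d i > (0::real)"
    "\<forall>i\<in>K. \<forall>j\<in>K. d i * A $ i $ j = d j * A $ j $ i" by blast
  then have "K = C" by (simp add: card_subset_eq)
  then show thesis using d that by blast
qed

text \<open>Data chosen on separate components fit together because entries between different
  components vanish.\<close>

lemma finite_type_weights:
  assumes "\<And>C. C \<in> conn_comps A K \<Longrightarrow> finite_type A C"
  obtains d u :: "'n \<Rightarrow> real" where "\<And>i. i \<in> K \<Longrightarrow> d i > 0" "\<And>i. i \<in> K \<Longrightarrow> u i > 0"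
    "\<And>i. i \<in> K \<Longrightarrow> sub_mult A K u i > 0"
    "\<And>i j. i \<in> K \<Longrightarrow> j \<in> K \<Longrightarrow> d i * A $ i $ j = d j * A $ j $ i"
proof -
  have "\<exists>d u :: 'n \<Rightarrow> real. (\<forall>i\<in>C. d i > 0 \<and> u i > 0 \<and> sub_mult A C u i > 0) \<and>
    (\<forall>i\<in>C. \<forall>j\<in>C. d i * A $ i $ j = d j * A $ j $ i)" if C: "C \<in> conn_comps A K" for C
  proof -
    obtain u where "\<forall>i\<in>C. u i > 0" "\<forall>i\<in>C. sub_mult A C u i > 0"
      using assms[OF C] unfolding finite_type_def by blast
    moreover obtain d :: "'n \<Rightarrow> real" where "\<And>i. i \<in> C \<Longrightarrow> d i > 0"
      "\<And>i j. i \<in> C \<Longrightarrow> j \<in> C \<Longrightarrow> d i * A $ i $ j = d j * A $ j $ i"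
      using finite_type_symmetrizable[OF assms[OF C]] by metis
    ultimately show ?thesis by blast
  qed
  then obtain D U where DU: "\<And>C i. C \<in> conn_comps A K \<Longrightarrow> i \<in> C \<Longrightarrow> D C i > (0::real) \<and> U C i > (0::real) \<and> sub_mult A C (U C) i > 0"
    "\<And>C i j. C \<in> conn_comps A K \<Longrightarrow> i \<in> C \<Longrightarrow> j \<in> C \<Longrightarrow> D C i * A $ i $ j = D C j * A $ j $ i"
    by metis
  define comp where "comp i = {j. (i, j) \<in> (Restr (dynkin A) K)\<^sup>*}" for i
  have comp: "comp i \<in> conn_comps A K" "i \<in> comp i" if "i \<in> K" for i
    using that unfolding comp_def conn_comps_def by auto
  have comp_eq: "comp j = comp i" if "i \<in> K" "j \<in> comp i" for i j
    using conn_comp_eq[OF comp(1)[OF that(1)] that(2)] by (simp add: comp_def)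
  define d where "d i = D (comp i) i" for i
  define u where "u i = U (comp i) i" for i
  show thesis
  proof (rule that[of d u])
    fix i assume i: "i \<in> K"
    show "d i > 0" "u i > 0" using DU(1)[OF comp[OF i]] by (auto simp: d_def u_def)
    have "sub_mult A K u i = sub_mult A (comp i) u i"
      using sub_mult_conn_comp[OF comp[OF i]] .
    also have "\<dots> = sub_mult A (comp i) (U (comp i)) i"
      unfolding sub_mult_def u_def by (rule sum.cong) (use comp_eq[OF i] in auto)
    finally show "sub_mult A K u i > 0" using DU(1)[OF comp[OF i]] by simp
    fix j assume j: "j \<in> K"
    show "d i * A $ i $ j = d j * A $ j $ i"
    proof (cases "j \<in> comp i")
      case True
      then show ?thesis using DU(2)[OF comp[OF i] True] comp_eq[OF i True] by (simp add: d_def)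
    next
      case False
      then have "A $ i $ j = 0" using conn_comp_closed[OF comp[OF i] j] by blast
      then show ?thesis using cartan_zero[of i j] by simp
    qed
  qed
qed

text \<open>For \<open>i \<noteq> j\<close> the weight \<open>d i * A $ i $ j\<close> is
  nonpositive, so it reverses \<open>2 c_i c_j \<le> (u_j / u_i) c_i^2 + (u_i / u_j) c_j^2\<close>.
  Summing over all pairs collects the row sums of \<open>A u\<close>. Where \<open>A u\<close> is
  positive, the form is positive definite.\<close>

lemma symmetrized_form_ge:
  fixes c d u :: "'n \<Rightarrow> real"
  assumes d: "\<And>i. i \<in> K \<Longrightarrow> d i > 0" and u: "\<And>i. i \<in> K \<Longrightarrow> u i > 0"
    and ds: "\<And>i j. i \<in> K \<Longrightarrow> j \<in> K \<Longrightarrow> d i * A $ i $ j = d j * A $ j $ i"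
  shows "(\<Sum>i\<in>K. d i * (sub_mult A K u i / u i) * (c i)\<^sup>2) \<le> (\<Sum>i\<in>K. d i * c i * sub_mult A K c i)"
proof -
  define f where "f i j = d i * A $ i $ j * (u j / u i) * (c i)\<^sup>2" for i j
  have "(\<Sum>i\<in>K. \<Sum>j\<in>K. f i j + f j i) \<le> (\<Sum>i\<in>K. \<Sum>j\<in>K. 2 * (d i * A $ i $ j * c i * c j))"
  proof (intro sum_mono)
    fix i j assume ij: "i \<in> K" "j \<in> K"
    let ?b = "d i * A $ i $ j"
    have "f i j + f j i = ?b * ((u j / u i) * (c i)\<^sup>2 + (u i / u j) * (c j)\<^sup>2)"
      using ds[OF ij] by (simp add: f_def algebra_simps)
    also have "\<dots> \<le> 2 * (?b * c i * c j)"
    proof (cases "i = j")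
      case True
      then show ?thesis using u[OF ij(1)] by (simp add: power2_eq_square)
    next
      case False
      have uu: "u i > 0" "u j > 0" using u ij by auto
      have "(u j / u i) * (c i)\<^sup>2 + (u i / u j) * (c j)\<^sup>2 - 2 * c i * c j = (u j * c i - u i * c j)\<^sup>2 / (u i * u j)"
        using uu by (simp add: power2_eq_square field_simps)
      also have "\<dots> \<ge> 0" using uu by simp
      finally have "2 * c i * c j \<le> (u j / u i) * (c i)\<^sup>2 + (u i / u j) * (c j)\<^sup>2" by simp
      moreover have "?b \<le> 0" using d[OF ij(1)] cartan_offdiag[OF False] by (simp add: mult_nonneg_nonpos)
      ultimately have "?b * ((u j / u i) * (c i)\<^sup>2 + (u i / u j) * (c j)\<^sup>2) \<le> ?b * (2 * c i * c j)"
        by (rule mult_left_mono_neg)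
      then show ?thesis by (simp add: mult_ac)
    qed
    finally show "f i j + f j i \<le> 2 * (?b * c i * c j)" .
  qed
  moreover have "(\<Sum>i\<in>K. \<Sum>j\<in>K. f j i) = (\<Sum>i\<in>K. \<Sum>j\<in>K. f i j)" by (rule sum.swap)
  ultimately have "(\<Sum>i\<in>K. \<Sum>j\<in>K. f i j) \<le> (\<Sum>i\<in>K. \<Sum>j\<in>K. d i * A $ i $ j * c i * c j)"
    by (simp add: sum.distrib flip: sum_distrib_left)
  moreover have "(\<Sum>j\<in>K. f i j) = d i * (sub_mult A K u i / u i) * (c i)\<^sup>2" for i
    by (simp add: f_def sub_mult_def sum_distrib_left sum_distrib_right sum_divide_distrib mult_ac)
  moreover have "(\<Sum>j\<in>K. d i * A $ i $ j * c i * c j) = d i * c i * sub_mult A K c i" for i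
    by (simp add: sub_mult_def sum_distrib_left mult_ac)
  ultimately show ?thesis by simp
qed

subsection \<open>Finite, affine and strongly hyperbolic matrices\<close>

text \<open>Restricting \<open>u\<close> to \<open>K\<close> drops nonpositive terms, and a strictly
  negative one in a row adjacent to the complement; thus \<open>u\<close> certifies finite type on
  \<open>K\<close>. Indecomposability of the whole matrix supplies such a row.\<close>

lemma proper_finite_type:
  assumes ind: "indecomposable A UNIV" and u: "\<And>i. u i > 0" and Au: "\<And>i. sub_mult A UNIV u i \<ge> 0"
    and K: "indecomposable A K" "K \<noteq> UNIV"
  shows "finite_type A K"
proof -
  have "\<exists>i\<in>K. \<exists>j\<in>- K. A $ i $ j \<noteq> 0"
  proof (rule ccontr)
    assume "\<not> ?thesis"
    then have "\<And>i j. i \<in> K \<Longrightarrow> j \<in> UNIV - K \<Longrightarrow> A $ i $ j = 0" by blast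
    then show False using indecomposable_closed[OF ind subset_UNIV indecomposable_nonempty[OF K(1)]] K(2) by blast
  qed
  then obtain i j where ij: "i \<in> K" "j \<notin> K" "A $ i $ j \<noteq> 0" by blast
  have split: "sub_mult A UNIV u p = sub_mult A K u p + (\<Sum>q\<in>- K. A $ p $ q * u q)" for p
    unfolding sub_mult_def using sum.subset_diff[of K UNIV "\<lambda>q. A $ p $ q * u q"] by (simp add: Compl_eq_Diff_UNIV add.commute)
  have term_le: "A $ p $ q * u q \<le> 0" if "p \<in> K" "q \<notin> K" for p q
    using cartan_offdiag[of p q] u[of q] that by (intro mult_nonpos_nonneg) (auto simp: less_imp_le)
  have le: "(\<Sum>q\<in>- K. A $ p $ q * u q) \<le> 0" if "p \<in> K" for p
    using term_le[OF that] by (intro sum_nonpos) auto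
  show ?thesis
  proof (rule finite_typeI[OF K(1) _ _ ij(1)])
    show "u p \<ge> 0" for p using u[of p] by simp
    show "sub_mult A K u p \<ge> 0" if "p \<in> K" for p using split[of p] Au[of p] le[OF that] by linarith
    have "(\<Sum>q\<in>- K. A $ i $ q * u q) = A $ i $ j * u j + (\<Sum>q\<in>- K - {j}. A $ i $ q * u q)"
      using ij by (intro sum.remove) auto
    moreover have "(\<Sum>q\<in>- K - {j}. A $ i $ q * u q) \<le> 0"
      using term_le[OF ij(1)] by (intro sum_nonpos) auto
    moreover have "i \<noteq> j" using ij by auto
    then have "A $ i $ j < 0" using cartan_offdiag[of i j] ij by simp
    then have "A $ i $ j * u j < 0" using u[of j] by (rule mult_neg_pos)
    ultimately show "sub_mult A K u i > 0" using split[of i] Au[of i] by linarith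
  qed
qed

text \<open>Each component omits its outer neighbour and is therefore proper. In the finite and
  affine cases the positive vector \<open>u\<close> restricts; in the strongly hyperbolic case
  finite type is part of the definition.\<close>

lemma components_finite_type:
  assumes type: "finite_type A UNIV \<or> affine_type A UNIV \<or> strongly_hyperbolic A"
    and C: "C \<in> conn_comps A (Pi_star A J \<inter> J)"
  shows "finite_type A C"
proof -
  have ind: "indecomposable A UNIV"
    using type by (auto simp: finite_type_def affine_type_def strongly_hyperbolic_def indefinite_type_def)
  obtain j where "j \<notin> J" using comp_has_outer_neighbour[OF C] by blast
  then have CU: "C \<noteq> UNIV" using conn_comp_subset[OF C] by blast
  note indC = conn_comp_indecomposable[OF C]
  consider "finite_type A UNIV" | "affine_type A UNIV" | "strongly_hyperbolic A" using type by blast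
  then show ?thesis
  proof cases
    case 1
    then have "\<exists>u. (\<forall>i\<in>UNIV. u i > 0) \<and> (\<forall>i\<in>UNIV. sub_mult A UNIV u i > 0)"
      unfolding finite_type_def by (elim conjE)
    then obtain u where "\<forall>i. u i > 0" "\<forall>i. sub_mult A UNIV u i > 0" by blast
    then show ?thesis using proper_finite_type[OF ind _ _ indC CU, of u] by (simp add: less_imp_le)
  next
    case 2
    then have "\<exists>u. (\<forall>i\<in>UNIV. u i > 0) \<and> (\<forall>i\<in>UNIV. sub_mult A UNIV u i = 0)"
      unfolding affine_type_def by (elim conjE)
    then obtain u where "\<forall>i. u i > 0" "\<forall>i. sub_mult A UNIV u i = 0" by blast
    then show ?thesis using proper_finite_type[OF ind _ _ indC CU, of u] by simp
  next
    case 3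
    then have "\<forall>K. K \<noteq> {} \<and> K \<subset> UNIV \<and> indecomposable A K \<longrightarrow> finite_type A K"
      unfolding strongly_hyperbolic_def by (elim conjE)
    moreover have "C \<subset> UNIV" using CU by auto
    ultimately show ?thesis using indC indecomposable_nonempty[OF indC] by metis
  qed
qed

end

subsection \<open>Quadratic inequalities, faces and duality\<close>

text \<open>With opposite signs the mixed term is nonnegative, \<open>a\<^sup>2 \<ge> 1\<close> by
  integrality, and \<open>dj * b\<^sup>2\<close> is positive, so the left side exceeds
  \<open>di\<close>.\<close>

lemma quadratic_not_mixed:
  fixes a b di dj :: real
  assumes "a \<in> \<int>" "b \<in> \<int>" "di > 0" "dj > 0" "c \<le> 0" "di * a\<^sup>2 + dj * b\<^sup>2 + c * a * b = di"
  shows "a * b \<ge> 0"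
proof (rule ccontr)
  assume "\<not> a * b \<ge> 0"
  then have "a \<noteq> 0" "b \<noteq> 0" and ab: "a * b < 0" by auto
  then have "\<bar>a\<bar> \<ge> 1" "\<bar>b\<bar> \<ge> 1" using assms(1,2) Ints_nonzero_abs_ge1 by blast+
  then have "a\<^sup>2 \<ge> 1" "b\<^sup>2 \<ge> 1" by (metis one_le_power power2_abs)+
  then have "di * a\<^sup>2 \<ge> di" "dj * b\<^sup>2 > 0" using assms by (auto simp: \<open>b \<noteq> 0\<close>)
  moreover have "c * a * b \<ge> 0"
    using mult_nonpos_nonpos[of c "a * b"] assms(5) ab by (simp add: mult.assoc)
  ultimately show False using assms(6) by linarith
qed

lemma quadratic_bounded:
  fixes c l m M :: real
  assumes "m > 0" "M \<ge> 0" "m * c\<^sup>2 + 2 * l * c \<le> M"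
  shows "\<bar>c\<bar> \<le> (2 * \<bar>l\<bar> + M) / m + 1"
proof (rule ccontr)
  assume "\<not> ?thesis"
  then have c: "\<bar>c\<bar> > (2 * \<bar>l\<bar> + M) / m + 1" by simp
  moreover have "(2 * \<bar>l\<bar> + M) / m \<ge> 0" using assms by simp
  ultimately have c1: "\<bar>c\<bar> > 1" by linarith
  have "m * \<bar>c\<bar> > 2 * \<bar>l\<bar> + M" using c assms(1) by (simp add: field_simps)
  then have "m * \<bar>c\<bar> * \<bar>c\<bar> > (2 * \<bar>l\<bar> + M) * \<bar>c\<bar>" using c1 by (intro mult_strict_right_mono) auto
  moreover have "M * \<bar>c\<bar> \<ge> M" using assms(2) c1 by (simp add: mult_le_cancel_left1)
  moreover have "2 * l * c \<ge> - (2 * \<bar>l\<bar> * \<bar>c\<bar>)"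
    by (metis abs_ge_minus_self abs_mult abs_numeral minus_le_iff)
  ultimately show False using assms(3) by (simp add: power2_eq_square algebra_simps)
qed

section \<open>Faces and edges of convex sets\<close>

lemma convex_diff_face:
  assumes "E face_of S" "convex S" shows "convex (S - E)"
  unfolding convex_contains_segment
proof (intro ballI subsetI)
  fix a b z assume ab: "a \<in> S - E" "b \<in> S - E" and z: "z \<in> closed_segment a b"
  have "z \<in> S" using assms(2) ab z unfolding convex_contains_segment by blast
  moreover have "z \<notin> E"
  proof
    assume "z \<in> E"
    then have "z \<in> open_segment a b" using z ab unfolding open_segment_def by auto
    then show False using face_ofD[OF assms(1) _ _ _ \<open>z \<in> E\<close>] ab by blast
  qed
  ultimately show "z \<in> S - E" by blast
qed

text \<open>The complement of a face is convex, so generators avoiding \<open>E\<close> would have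
  their whole hull avoiding \<open>E\<close>.\<close>

lemma face_meets_hull_generators:
  assumes "E face_of S" "convex S" "P \<subseteq> S" "p \<in> convex hull P" "p \<in> E"
  shows "P \<inter> E \<noteq> {}"
proof
  assume "P \<inter> E = {}"
  then have "convex hull P \<subseteq> S - E"
    using assms convex_diff_face by (intro hull_minimal) auto
  then show False using assms by blast
qed

lemma edge_in_line:
  assumes "edge_in E S" "x \<in> E" "y \<in> E" "x \<noteq> y" "z \<in> E"
  shows "\<exists>t. z = x + t *\<^sub>R (y - x)"
proof -
  let ?D = "{x - y | x y. x \<in> E \<and> y \<in> E}"
  obtain B where B: "B \<subseteq> ?D" "independent B" "?D \<subseteq> span B" "card B = dim ?D"
    using basis_exists[of ?D] by blast
  then obtain b where "B = {b}" using assms(1) by (auto simp: edge_in_def card_1_singleton_iff)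
  then have span: "\<And>d. d \<in> ?D \<Longrightarrow> \<exists>r. d = r *\<^sub>R b" using B(3) by (auto simp: span_singleton)
  obtain r where r: "y - x = r *\<^sub>R b" using span[of "y - x"] assms by blast
  obtain q where q: "z - x = q *\<^sub>R b" using span[of "z - x"] assms by blast
  have "r \<noteq> 0" using r assms(4) by auto
  then have "z - x = (q / r) *\<^sub>R (y - x)" using r q by simp
  then have "z = x + (q / r) *\<^sub>R (y - x)" by (metis add.commute diff_add_cancel)
  then show ?thesis by blast
qed

text \<open>Two distinct points fix the line carrying an edge. A third point of \<open>E'\<close>
  lies between them, where convexity applies, or beyond one of them, which is then interior to a
  segment in \<open>S\<close>, where the face property applies.\<close>

lemma edge_in_subset:
  assumes E: "edge_in E S" and E': "edge_in E' S" and xy: "x \<in> E \<inter> E'" "y \<in> E \<inter> E'" "x \<noteq> y"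
  shows "E' \<subseteq> E"
proof
  fix z assume z: "z \<in> E'"
  have face: "E face_of S" and sub: "E' \<subseteq> S" "E \<subseteq> S" and cv: "convex E"
    using E E' by (auto simp: edge_in_def face_of_def)
  obtain t where t: "z = x + t *\<^sub>R (y - x)" using edge_in_line[OF E', of x y z] xy z by auto
  have zS: "z \<in> S" "x \<in> S" "y \<in> S" using z sub xy by auto
  consider "0 \<le> t" "t \<le> 1" | "t > 1" | "t < 0" by linarith
  then show "z \<in> E"
  proof cases
    case 1
    then have "z \<in> closed_segment x y" unfolding in_segment t by (intro exI[of _ t]) (simp add: algebra_simps)
    then show ?thesis using cv xy unfolding convex_contains_segment by blast
  next
    case 2
    have "z - x = t *\<^sub>R (y - x)" by (simp add: t)
    then have "x \<noteq> z" using 2 xy(3) by auto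
    moreover have "y = (1 - 1 / t) *\<^sub>R x + (1 / t) *\<^sub>R z"
      using 2 by (simp add: t algebra_simps)
    ultimately have "y \<in> open_segment x z" unfolding in_segment using 2 by (intro conjI exI[of _ "1 / t"]) auto
    then show ?thesis using face_ofD[OF face _ zS(2,1)] xy by blast
  next
    case 3
    \<comment> \<open>This \<open>r\<close> solves \<open>r (1 - t) = 1\<close>, which is the
      condition for \<open>x = r z + (1 - r) y\<close>.\<close>
    define r where "r = 1 / (1 - t)"
    have r: "0 < r" "r < 1" "r * t = r - 1" using 3 by (auto simp: r_def field_simps)
    have "z \<noteq> y"
    proof
      assume "z = y"
      then have "1 *\<^sub>R (y - x) = t *\<^sub>R (y - x)" using t by (metis add_diff_cancel_left' scaleR_one)
      then have "1 = t \<or> y - x = 0" by (simp only: scaleR_cancel_right)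
      then show False using 3 xy(3) by auto
    qed
    moreover have "x = (1 - (1 - r)) *\<^sub>R z + (1 - r) *\<^sub>R y"
    proof -
      have "(1 - (1 - r)) *\<^sub>R z + (1 - r) *\<^sub>R y = r *\<^sub>R x + (r * t) *\<^sub>R (y - x) + (1 - r) *\<^sub>R y"
        by (simp add: t scaleR_right_distrib)
      also have "\<dots> = x" unfolding r(3) by (simp add: algebra_simps)
      finally show ?thesis by simp
    qed
    ultimately have "x \<in> open_segment z y" unfolding in_segment using r by (intro conjI exI[of _ "1 - r"]) auto
    then show ?thesis using face_ofD[OF face _ zS(1,3)] xy by blast
  qed
qed

section \<open>Functionals, dual vectors and separation\<close>

definition riesz :: "('h::euclidean_space \<Rightarrow>\<^sub>L real) \<Rightarrow> 'h" where
  "riesz \<eta> = (\<Sum>b\<in>Basis. blinfun_apply \<eta> b *\<^sub>R b)"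

lemma riesz_inner: "a \<bullet> riesz \<eta> = blinfun_apply \<eta> a"
proof -
  have "a \<bullet> riesz \<eta> = (\<Sum>b\<in>Basis. (a \<bullet> b) * blinfun_apply \<eta> b)"
    by (simp add: riesz_def inner_sum_right mult.commute)
  also have "\<dots> = blinfun_apply \<eta> (\<Sum>b\<in>Basis. (a \<bullet> b) *\<^sub>R b)"
    by (simp add: blinfun.sum_right blinfun.scaleR_right)
  finally show ?thesis by (simp add: euclidean_representation)
qed

lemma linear_riesz: "linear riesz"
  by (rule linearI) (simp_all add: riesz_def blinfun.add_left blinfun.scaleR_left
      scaleR_left_distrib sum.distrib scaleR_sum_right)

lemma inj_riesz: "inj riesz"
  by (rule injI, rule blinfun_eqI) (metis riesz_inner)

text \<open>A finitely generated cone is closed, so it can be separated from \<open>\<eta>\<close>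
  after \<open>riesz\<close> carries the dual into the Euclidean space. Because the cone is
  invariant under scaling, the threshold \<open>b\<close> can be moved to 0.\<close>

lemma separate_convex_cone:
  fixes G :: "('h::euclidean_space \<Rightarrow>\<^sub>L real) set"
  assumes "finite G" "\<eta> \<notin> convex_cone hull G"
  obtains a where "blinfun_apply \<eta> a < 0" "\<And>g. g \<in> G \<Longrightarrow> blinfun_apply g a \<ge> 0"
proof -
  let ?K = "convex_cone hull (riesz ` G)"
  have "riesz \<eta> \<notin> ?K"
    unfolding convex_cone_hull_linear_image[OF linear_riesz]
    using assms(2) inj_image_mem_iff[OF inj_riesz] by metis
  moreover have "convex ?K" "closed ?K"
    using assms(1) by (auto intro: convex_convex_cone_hull closed_convex_cone_hull)
  ultimately obtain a b where ab: "a \<bullet> riesz \<eta> < b" "\<And>y. y \<in> ?K \<Longrightarrow> a \<bullet> y > b"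
    using separating_hyperplane_closed_point by metis
  have b: "b < 0" using ab(2)[OF convex_cone_hull_contains_0] by simp
  have "a \<bullet> y \<ge> 0" if y: "y \<in> ?K" for y
  proof (rule ccontr)
    assume "\<not> a \<bullet> y \<ge> 0"
    then have neg: "a \<bullet> y < 0" by simp
    \<comment> \<open>The factor places the scaled vector exactly at height \<open>b\<close>, which
      strict separation forbids.\<close>
    then have "(b / (a \<bullet> y)) *\<^sub>R y \<in> ?K" using b by (intro convex_cone_hull_mul y divide_nonpos_nonpos) auto
    from ab(2)[OF this] show False using neg by simp
  qed
  then have "blinfun_apply g a \<ge> 0" if "g \<in> G" for g
    using that hull_inc[of "riesz g" "riesz ` G" convex_cone] by (auto simp: riesz_inner[symmetric])
  moreover have "blinfun_apply \<eta> a < 0" using ab(1) b by (simp add: riesz_inner)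
  ultimately show thesis using that by blast
qed

text \<open>The component of \<open>\<alpha> i\<close> orthogonal to the other simple roots kills
  them and is nonzero by independence; dividing by its squared norm normalizes it.\<close>

lemma dual_vector_exists:
  fixes \<alpha> :: "'n \<Rightarrow> ('h::euclidean_space) \<Rightarrow>\<^sub>L real"
  assumes "inj \<alpha>" "independent (range \<alpha>)"
  shows "\<exists>e. \<forall>j. blinfun_apply (\<alpha> j) e = (if i = j then 1 else 0)"
proof -
  have ind: "independent (riesz ` range \<alpha>)"
    by (rule linear_independent_injective_image[OF linear_riesz assms(2)]) (rule inj_on_subset[OF inj_riesz subset_UNIV])
  have inj: "inj (\<lambda>i. riesz (\<alpha> i))" using inj_compose[OF inj_riesz assms(1)] by (simp add: comp_def)
  obtain y z where yz: "y \<in> span (riesz ` \<alpha> ` (- {i}))"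
    "\<And>w. w \<in> span (riesz ` \<alpha> ` (- {i})) \<Longrightarrow> orthogonal z w" "riesz (\<alpha> i) = y + z"
    using orthogonal_subspace_decomp_exists[of "riesz ` \<alpha> ` (- {i})" "riesz (\<alpha> i)"] by metis
  have "riesz ` range \<alpha> - {riesz (\<alpha> i)} = riesz ` \<alpha> ` (- {i})"
    using inj by (auto simp: inj_def)
  then have "riesz (\<alpha> i) \<notin> span (riesz ` \<alpha> ` (- {i}))"
    using ind unfolding dependent_def by (metis imageI rangeI)
  then have z0: "z \<noteq> 0" using yz by auto
  have "z \<bullet> riesz (\<alpha> i) = z \<bullet> z" using yz by (simp add: inner_add_right orthogonal_def)
  moreover have "z \<bullet> riesz (\<alpha> j) = 0" if "j \<noteq> i" for j
    using yz(2)[of "riesz (\<alpha> j)"] that by (auto simp: orthogonal_def intro: span_base)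
  ultimately have "blinfun_apply (\<alpha> j) ((1 / (z \<bullet> z)) *\<^sub>R z) = (if i = j then 1 else 0)" for j
    using z0 by (auto simp: riesz_inner[symmetric])
  then show ?thesis by blast
qed

text \<open>This is the vector rho of the theory of root systems. Reflecting it in
  \<open>\<alpha> k\<close> subtracts exactly \<open>\<alpha> k\<close>, which
  \<open>hull_in_cone\<close> exploits.\<close>

lemma weight_exists:
  fixes \<alpha>v :: "'n \<Rightarrow> 'h::euclidean_space"
  assumes "inj \<alpha>v" "independent (range \<alpha>v)"
  obtains \<rho> :: "'h \<Rightarrow>\<^sub>L real" where "\<And>i. \<rho> (\<alpha>v i) = 1"
proof -
  obtain g :: "'h \<Rightarrow> real" where g: "linear g" "\<forall>x\<in>range \<alpha>v. g x = 1"
    using linear_independent_extend[OF assms(2), of "\<lambda>_. 1"] by blast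
  then have "blinfun_apply (Blinfun g) = g" by (simp add: bounded_linear_Blinfun_apply linear_conv_bounded_linear)
  then show thesis using that[of "Blinfun g"] g by auto
qed

subsection \<open>The Weyl group\<close>

text \<open>The vectors \<open>e k\<close> read off the coefficient of \<open>\<alpha> k\<close> in
  any combination of simple roots.\<close>

locale cartan_data = cartan_matrix A
  for A :: "real^'n^'n" +
  fixes \<alpha> :: "'n \<Rightarrow> ('h::euclidean_space) \<Rightarrow>\<^sub>L real" and \<alpha>v :: "'n \<Rightarrow> 'h" and e :: "'n \<Rightarrow> 'h"
  assumes pairing: "blinfun_apply (\<alpha> j) (\<alpha>v i) = A $ i $ j"
    and dual_basis: "blinfun_apply (\<alpha> j) (e i) = (if i = j then 1 else 0)"
begin

abbreviation s :: "'n \<Rightarrow> ('h \<Rightarrow>\<^sub>L real) \<Rightarrow> ('h \<Rightarrow>\<^sub>L real)" where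
  "s \<equiv> simple_refl \<alpha> \<alpha>v"

definition act :: "'n list \<Rightarrow> ('h \<Rightarrow>\<^sub>L real) \<Rightarrow> ('h \<Rightarrow>\<^sub>L real)" where
  "act ws = foldr s ws"

text \<open>On the span of the simple roots this says that all coefficients are nonnegative;
  elsewhere it depends on the choice of \<open>e\<close>.\<close>

definition pos :: "('h \<Rightarrow>\<^sub>L real) \<Rightarrow> bool" where
  "pos \<eta> \<longleftrightarrow> (\<forall>k. \<eta> (e k) \<ge> 0)"

text \<open>The Coxeter length of the group element represented by \<open>ws\<close>, not the length
  of the word.\<close>

definition len :: "'n list \<Rightarrow> nat" where
  "len ws = (LEAST n. \<exists>ys. length ys = n \<and> act ys = act ws)"

lemma s_apply: "blinfun_apply (s i \<eta>) x = \<eta> x - \<eta> (\<alpha>v i) * blinfun_apply (\<alpha> i) x"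
  by (simp add: simple_refl_def blinfun.diff_left blinfun.scaleR_left)

lemma s_s [simp]: "s i (s i \<eta>) = \<eta>"
  by (rule blinfun_eqI) (simp add: s_apply pairing cartan_diag)

lemma s_simple_root: "s i (\<alpha> i) = - \<alpha> i"
  by (rule blinfun_eqI) (simp add: s_apply pairing cartan_diag blinfun.minus_left)

lemma linear_s: "linear (s i)"
  by (rule linearI; rule blinfun_eqI)
     (simp_all add: s_apply blinfun.add_left blinfun.scaleR_left algebra_simps)

lemma act_Nil [simp]: "act [] \<eta> = \<eta>"
  and act_Cons [simp]: "act (i # ws) \<eta> = s i (act ws \<eta>)"
  and act_append [simp]: "act (ws @ ys) \<eta> = act ws (act ys \<eta>)"
  by (simp_all add: act_def)

lemma linear_act: "linear (act ws)"
proof (induction ws)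
  case Nil
  show ?case by (rule linearI) (simp_all add: act_def)
next
  case (Cons i ws)
  have "act (i # ws) = s i \<circ> act ws" by (simp add: act_def)
  then show ?case using linear_compose[OF Cons linear_s] by metis
qed

lemmas act_diff = linear_diff[OF linear_act]
  and act_minus = linear_neg[OF linear_act]
  and act_add = linear_add[OF linear_act]
  and act_scale = linear_scale[OF linear_act]
  and act_sum = linear_sum[OF linear_act]

lemma act_rev_act [simp]: "act (rev ws) (act ws \<eta>) = \<eta>"
  by (induction ws arbitrary: \<eta>) auto

lemma act_act_rev [simp]: "act ws (act (rev ws) \<eta>) = \<eta>"
  using act_rev_act[of "rev ws"] by simp

lemma weyl_group_eq: "weyl_group \<alpha> \<alpha>v = range act"
proof (intro equalityI subsetI)
  fix w assume "w \<in> weyl_group \<alpha> \<alpha>v"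
  then show "w \<in> range act"
  proof induction
    case one
    show ?case by (rule range_eqI[of _ _ "[]"]) (auto simp: act_def)
  next
    case (refl i)
    show ?case by (rule range_eqI[of _ _ "[i]"]) (auto simp: act_def)
  next
    case (inverse w)
    then obtain ws where w: "w = act ws" by blast
    have "inv w = act (rev ws)"
      unfolding w by (rule inv_unique_comp) (auto simp: fun_eq_iff)
    then show ?case by blast
  next
    case (mult w w')
    then obtain ws ys where "w = act ws" "w' = act ys" by blast
    then have "w \<circ> w' = act (ws @ ys)" by (auto simp: act_def)
    then show ?case by blast
  qed
next
  fix w assume "w \<in> range act"
  then obtain ws where "w = act ws" by blast
  moreover have "act ws \<in> weyl_group \<alpha> \<alpha>v"
  proof (induction ws)
    case Nil
    have "act [] = id" by (auto simp: act_def)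
    then show ?case using weyl_group.one by metis
  next
    case (Cons i ws)
    have "act (i # ws) = s i \<circ> act ws" by (auto simp: act_def)
    then show ?case using weyl_group.mult[OF weyl_group.refl Cons] by metis
  qed
  ultimately show "w \<in> weyl_group \<alpha> \<alpha>v" by simp
qed

section \<open>Length of Weyl group elements\<close>

lemma len_witness: obtains ys where "length ys = len ws" "act ys = act ws"
proof -
  have "\<exists>ys. length ys = len ws \<and> act ys = act ws"
    unfolding len_def by (rule LeastI) blast
  then show thesis using that by blast
qed

lemma len_le: "act ys = act ws \<Longrightarrow> len ws \<le> length ys"
  unfolding len_def by (rule Least_le) blast

lemma len_cong: "act ws = act ys \<Longrightarrow> len ws = len ys"
  by (simp add: len_def)

lemma len_append: "len (xs @ ys) \<le> len xs + len ys"
proof -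
  obtain xs' ys' where "length xs' = len xs" "act xs' = act xs" "length ys' = len ys" "act ys' = act ys"
    by (metis len_witness)
  then show ?thesis using len_le[of "xs' @ ys'" "xs @ ys"] by (auto simp: fun_eq_iff)
qed

subsection \<open>Rank two\<close>

text \<open>
  In rank two the Cartan matrix is symmetrizable. The integral form
  \<open>d\<^sub>i a\<^sup>2 + d\<^sub>j b\<^sup>2 + d\<^sub>i a\<^sub>i\<^sub>j a b\<close> is invariant, equals \<open>d\<^sub>i\<close> at \<open>\<alpha>\<^sub>i\<close>, and
  exceeds \<open>d\<^sub>i\<close> at integers \<open>a\<close>, \<open>b\<close> of opposite signs.
\<close>

lemma rank2_orbit:
  fixes di dj :: real
  assumes "set u \<subseteq> {i, j}" and sym: "di * A $ i $ j = dj * A $ j $ i"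
  obtains a b where "a \<in> \<int>" "b \<in> \<int>" "act u (\<alpha> i) = a *\<^sub>R \<alpha> i + b *\<^sub>R \<alpha> j"
    "di * a\<^sup>2 + dj * b\<^sup>2 + di * A $ i $ j * a * b = di"
    "\<And>\<eta>. a * di * act u \<eta> (\<alpha>v i) + b * dj * act u \<eta> (\<alpha>v j) = di * \<eta> (\<alpha>v i)"
proof -
  \<comment> \<open>The last conjunct is invariance of the pairing between the root and a weight
    \<open>\<eta>\<close>; \<open>rank2_reflection\<close> uses it to compare coroots.\<close>
  have "\<exists>a b. a \<in> \<int> \<and> b \<in> \<int> \<and> act u (\<alpha> i) = a *\<^sub>R \<alpha> i + b *\<^sub>R \<alpha> j \<and>
    di * a\<^sup>2 + dj * b\<^sup>2 + di * A $ i $ j * a * b = di \<and>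
    (\<forall>\<eta>. a * di * act u \<eta> (\<alpha>v i) + b * dj * act u \<eta> (\<alpha>v j) = di * \<eta> (\<alpha>v i))"
    using assms(1)
  proof (induction u)
    case Nil
    show ?case by (rule exI[of _ 1], rule exI[of _ 0]) simp
  next
    case (Cons p u)
    then obtain a b where ab: "a \<in> \<int>" "b \<in> \<int>" "act u (\<alpha> i) = a *\<^sub>R \<alpha> i + b *\<^sub>R \<alpha> j"
      and Q: "di * a\<^sup>2 + dj * b\<^sup>2 + di * A $ i $ j * a * b = di"
      and inv: "\<And>\<eta>. a * di * act u \<eta> (\<alpha>v i) + b * dj * act u \<eta> (\<alpha>v j) = di * \<eta> (\<alpha>v i)"
      by auto
    from Cons consider "p = i" | "p = j" by auto
    then show ?case
    proof cases
      case 1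
      let ?a = "- a - b * A $ i $ j"
      have "?a \<in> \<int>" using ab cartan_Ints by auto
      moreover have "act (p # u) (\<alpha> i) = ?a *\<^sub>R \<alpha> i + b *\<^sub>R \<alpha> j"
        by (rule blinfun_eqI) (simp add: 1 ab(3) s_apply pairing cartan_diag blinfun.add_left
            blinfun.scaleR_left, simp add: algebra_simps)
      moreover have "di * ?a\<^sup>2 + dj * b\<^sup>2 + di * A $ i $ j * ?a * b = di"
        using Q by (simp add: power2_eq_square algebra_simps)
      moreover have "?a * di * act (p # u) \<eta> (\<alpha>v i) + b * dj * act (p # u) \<eta> (\<alpha>v j) = di * \<eta> (\<alpha>v i)" for \<eta>
      proof -
        have "?a * di * act (p # u) \<eta> (\<alpha>v i) + b * dj * act (p # u) \<eta> (\<alpha>v j)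
          = a * di * act u \<eta> (\<alpha>v i) + b * dj * act u \<eta> (\<alpha>v j)
            + b * act u \<eta> (\<alpha>v i) * (di * A $ i $ j - dj * A $ j $ i)"
          by (simp add: 1 s_apply pairing cartan_diag algebra_simps)
        then show ?thesis using inv sym by simp
      qed
      ultimately show ?thesis using ab(2) by blast
    next
      case 2
      let ?b = "- b - a * A $ j $ i"
      have "?b \<in> \<int>" using ab cartan_Ints by auto
      moreover have "act (p # u) (\<alpha> i) = a *\<^sub>R \<alpha> i + ?b *\<^sub>R \<alpha> j"
        by (rule blinfun_eqI) (simp add: 2 ab(3) s_apply pairing cartan_diag blinfun.add_left
            blinfun.scaleR_left, simp add: algebra_simps)
      moreover have "di * a\<^sup>2 + dj * ?b\<^sup>2 + di * A $ i $ j * a * ?b = di"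
      proof -
        have "di * a\<^sup>2 + dj * ?b\<^sup>2 + di * A $ i $ j * a * ?b =
          (di * a\<^sup>2 + dj * b\<^sup>2 + di * A $ i $ j * a * b)
           - (di * A $ i $ j - dj * A $ j $ i) * (2 * a * b + a * a * A $ j $ i)"
          by (simp add: power2_eq_square algebra_simps)
        then show ?thesis using Q sym by simp
      qed
      moreover have "a * di * act (p # u) \<eta> (\<alpha>v i) + ?b * dj * act (p # u) \<eta> (\<alpha>v j) = di * \<eta> (\<alpha>v i)" for \<eta>
      proof -
        have "a * di * act (p # u) \<eta> (\<alpha>v i) + ?b * dj * act (p # u) \<eta> (\<alpha>v j)
          = a * di * act u \<eta> (\<alpha>v i) + b * dj * act u \<eta> (\<alpha>v j)
            - a * act u \<eta> (\<alpha>v j) * (di * A $ i $ j - dj * A $ j $ i)"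
          by (simp add: 2 s_apply pairing cartan_diag algebra_simps)
        then show ?thesis using inv sym by simp
      qed
      ultimately show ?thesis using ab(1) by blast
    qed
  qed
  then show thesis using that by blast
qed

lemma rank2_symmetrizable:
  assumes "i \<noteq> j"
  obtains di dj :: real where "di > 0" "dj > 0" "di * A $ i $ j = dj * A $ j $ i"
proof (cases "A $ i $ j = 0")
  case True
  then show ?thesis using that[of 1 1] cartan_zero by simp
next
  case False
  then have "A $ i $ j < 0" "A $ j $ i < 0"
    using cartan_zero cartan_offdiag assms by (metis less_eq_real_def)+
  then show ?thesis using that[of "- A $ j $ i" "- A $ i $ j"] by simp
qed

lemma rank2_signs:
  assumes "i \<noteq> j" "set u \<subseteq> {i, j}"
  obtains a b where "act u (\<alpha> i) = a *\<^sub>R \<alpha> i + b *\<^sub>R \<alpha> j"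
    "a \<ge> 0 \<and> b \<ge> 0 \<or> a \<le> 0 \<and> b \<le> 0"
proof -
  obtain di dj :: real where d: "di > 0" "dj > 0" "di * A $ i $ j = dj * A $ j $ i"
    using rank2_symmetrizable[OF assms(1)] .
  obtain a b where ab: "a \<in> \<int>" "b \<in> \<int>" "act u (\<alpha> i) = a *\<^sub>R \<alpha> i + b *\<^sub>R \<alpha> j"
    "di * a\<^sup>2 + dj * b\<^sup>2 + di * A $ i $ j * a * b = di"
    using rank2_orbit[OF assms(2) d(3)] by metis
  have "a * b \<ge> 0"
    using quadratic_not_mixed[OF ab(1,2) d(1,2) _ ab(4)] d(1) cartan_offdiag[OF assms(1)]
    by (simp add: mult_le_0_iff)
  then show thesis using that[OF ab(3)] by (auto simp: zero_le_mult_iff)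
qed

lemma rank2_coord:
  assumes "i \<noteq> j" "act u (\<alpha> i) = a *\<^sub>R \<alpha> i + b *\<^sub>R \<alpha> j"
  shows "act u (\<alpha> i) (e i) = a" "act u (\<alpha> i) (e j) = b"
  using assms by (simp_all add: blinfun.add_left blinfun.scaleR_left dual_basis)

text \<open>Conjugating a reflection by \<open>u\<close> reflects in the image root. By the
  invariant pairing, \<open>act u \<eta>\<close> takes at the coroot of \<open>p\<close> the value
  \<open>c\<close> times that of \<open>\<eta>\<close> at the coroot of \<open>i\<close>; the factor
  \<open>c\<close> then combines with \<open>\<alpha> p\<close> into
  \<open>act u (\<alpha> i)\<close>.\<close>

lemma rank2_reflection:
  assumes "i \<noteq> j" "set u \<subseteq> {i, j}" "p \<in> {i, j}" "act u (\<alpha> i) = c *\<^sub>R \<alpha> p"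
  shows "s p (act u \<eta>) = act u (s i \<eta>)"
proof -
  obtain di dj :: real where d: "di > 0" "dj > 0" "di * A $ i $ j = dj * A $ j $ i"
    using rank2_symmetrizable[OF assms(1)] .
  obtain a b where ab: "act u (\<alpha> i) = a *\<^sub>R \<alpha> i + b *\<^sub>R \<alpha> j"
    "di * a\<^sup>2 + dj * b\<^sup>2 + di * A $ i $ j * a * b = di"
    "\<And>\<eta>. a * di * act u \<eta> (\<alpha>v i) + b * dj * act u \<eta> (\<alpha>v j) = di * \<eta> (\<alpha>v i)"
    using rank2_orbit[OF assms(2) d(3)] by metis
  note co = rank2_coord[OF assms(1) ab(1), unfolded assms(4)]
  have key: "act u \<eta> (\<alpha>v p) = c * \<eta> (\<alpha>v i)"
  proof (cases "p = i")
    case True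
    then have "a = c" "b = 0" using co assms(1) by (auto simp: blinfun.scaleR_left dual_basis)
    then have "c\<^sup>2 = 1" "c * act u \<eta> (\<alpha>v i) = \<eta> (\<alpha>v i)" using ab(2) ab(3)[of \<eta>] d by auto
    then show ?thesis using True by (metis mult.assoc mult_1 power2_eq_square)
  next
    case False
    then have p: "p = j" "a = 0" "b = c" using co assms(1,3) by (auto simp: blinfun.scaleR_left dual_basis)
    then have "c\<^sup>2 * dj = di" "c * dj * act u \<eta> (\<alpha>v j) = di * \<eta> (\<alpha>v i)"
      using ab(2) ab(3)[of \<eta>] by (auto simp: mult.commute)
    then have "c * dj * act u \<eta> (\<alpha>v j) = c * dj * (c * \<eta> (\<alpha>v i))" "c * dj \<noteq> 0"
      using d by (auto simp: power2_eq_square algebra_simps)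
    then have "act u \<eta> (\<alpha>v j) = c * \<eta> (\<alpha>v i)" by (metis mult_left_cancel)
    then show ?thesis using p by simp
  qed
  have "s p (act u \<eta>) = act u \<eta> - act u \<eta> (\<alpha>v p) *\<^sub>R \<alpha> p" by (simp add: simple_refl_def)
  also have "\<dots> = act u \<eta> - \<eta> (\<alpha>v i) *\<^sub>R act u (\<alpha> i)" by (simp add: key assms(4))
  also have "\<dots> = act u (s i \<eta>)" by (simp add: simple_refl_def act_diff act_scale)
  finally show ?thesis .
qed

text \<open>The exchange condition in rank two. Read from the right, some letter \<open>p\<close>
  first turns the root negative; there the tail carries \<open>\<alpha> i\<close> to a multiple of
  \<open>\<alpha> p\<close>, so \<open>p\<close> cancels against the final \<open>i\<close>.\<close>

lemma rank2_exchange: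
  assumes "i \<noteq> j" "set u \<subseteq> {i, j}" "act u (\<alpha> i) = a *\<^sub>R \<alpha> i + b *\<^sub>R \<alpha> j" "a \<le> 0" "b \<le> 0"
  shows "\<exists>u'. length u = Suc (length u') \<and> act u' = act (u @ [i])"
  using assms(2-)
proof (induction u arbitrary: a b)
  case Nil
  then have "a = 1" using rank2_coord(1)[OF assms(1) Nil(2)] by (simp add: dual_basis)
  then show ?case using Nil by simp
next
  case (Cons p u)
  obtain a' b' where ab': "act u (\<alpha> i) = a' *\<^sub>R \<alpha> i + b' *\<^sub>R \<alpha> j"
    "a' \<ge> 0 \<and> b' \<ge> 0 \<or> a' \<le> 0 \<and> b' \<le> 0"
    using rank2_signs[OF assms(1), of u] Cons(2) by (metis list.set_intros(2) subset_iff)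
  show ?case
  proof (cases "a' \<le> 0 \<and> b' \<le> 0")
    case True
    have "set u \<subseteq> {i, j}" using Cons(2) by simp
    from Cons.IH[OF this ab'(1)] True
    obtain u' where "length u = Suc (length u')" "act u' = act (u @ [i])" by blast
    then show ?thesis by (intro exI[of _ "p # u'"]) (auto simp: fun_eq_iff)
  next
    case False
    then have pos': "a' \<ge> 0" "b' \<ge> 0" using ab' by auto
    note co = rank2_coord[OF assms(1) Cons(3)] and co' = rank2_coord[OF assms(1) ab'(1)]
    have p: "p \<in> {i, j}" using Cons(2) by auto
    \<comment> \<open>The reflection in \<open>p\<close> changes only the coefficient of
      \<open>\<alpha> p\<close>, so the other one is both nonnegative and nonpositive.\<close>
    have "\<exists>c. act u (\<alpha> i) = c *\<^sub>R \<alpha> p"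
    proof (cases "p = i")
      case True
      then have "b = b'" using co(2) co'(2) assms(1) by (simp add: s_apply dual_basis)
      then show ?thesis using ab'(1) True pos' Cons(5) by auto
    next
      case False
      then have "a = a'" "p = j" using co(1) co'(1) p assms(1) by (auto simp: s_apply dual_basis)
      then show ?thesis using ab'(1) pos' Cons(4) by auto
    qed
    then obtain c where "act u (\<alpha> i) = c *\<^sub>R \<alpha> p" ..
    moreover have "set u \<subseteq> {i, j}" using Cons(2) by simp
    ultimately have "s p (act u \<eta>) = act u (s i \<eta>)" for \<eta>
      using rank2_reflection[OF assms(1) _ p] by blast
    then have "act ((p # u) @ [i]) \<eta> = act u \<eta>" for \<eta>
      unfolding act_append act_Cons act_Nil by (metis s_s)
    then show ?thesis by (intro exI[of _ u]) auto
  qed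
qed

subsection \<open>Sign coherence of real roots\<close>

lemma pos_add: "pos x \<Longrightarrow> pos y \<Longrightarrow> pos (x + y)"
  and pos_scale: "pos x \<Longrightarrow> c \<ge> 0 \<Longrightarrow> pos (c *\<^sub>R x)"
  and pos_simple: "pos (\<alpha> i)"
  by (auto simp: pos_def blinfun.add_left blinfun.scaleR_left dual_basis)

text \<open>
  The element is written as \<open>v u\<close> with \<open>u\<close> in a rank two parabolic subgroup and \<open>v\<close> as
  short as possible; the induction hypothesis applies to \<open>v\<close>.
\<close>

lemma pos_of_len_le:
  assumes "len ws \<le> len (ws @ [i])"
  shows "pos (act ws (\<alpha> i))"
  using assms
proof (induction "len ws" arbitrary: ws i rule: less_induct)
  case less
  obtain ys where ys: "length ys = len ws" "act ys = act ws" by (rule len_witness)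
  show ?case
  proof (cases ys rule: rev_cases)
    case Nil
    then show ?thesis using ys(2) pos_simple by (metis act_Nil)
  next
    case (snoc zs j)
    have ij: "i \<noteq> j"
    proof
      assume "i = j"
      then have "act zs \<eta> = act (ws @ [i]) \<eta>" for \<eta> unfolding act_append ys(2)[symmetric] snoc by simp
      then have "act zs = act (ws @ [i])" by blast
      then have "len (ws @ [i]) \<le> length zs" using len_le by blast
      then show False using ys(1) snoc less.prems by simp
    qed
    \<comment> \<open>\<open>P v u\<close> says that \<open>ws\<close> factors as \<open>v\<close>
      times \<open>u\<close> with lengths adding up. Splitting off the last letter \<open>j\<close>
      of a reduced word gives one such factorization.\<close>
    define P where "P v u \<longleftrightarrow> act (v @ u) = act ws \<and> set u \<subseteq> {i, j} \<and> len v + length u = len ws" for v u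
    have "len zs \<le> length zs" using len_le by blast
    moreover have "len ws \<le> len zs + len [j]"
      using len_append[of zs "[j]"] len_cong[of "zs @ [j]" ws] ys(2) snoc by simp
    moreover have "len [j] \<le> 1" using len_le[of "[j]" "[j]"] by simp
    ultimately have lz: "len zs + 1 = len ws" using ys(1) snoc by simp
    then have Pz: "P zs [j]" using ys snoc by (simp add: P_def)
    then obtain v where v: "\<exists>u. P v u" and min: "\<And>v'. \<exists>u. P v' u \<Longrightarrow> len v \<le> len v'"
      using ex_has_least_nat[of "\<lambda>v. \<exists>u. P v u" zs len] Pz by blast
    from v obtain u where u: "P v u" ..
    have "len v \<le> len zs" using min Pz by blast
    then have lv: "len v < len ws" using lz by simp
    \<comment> \<open>If \<open>v @ [k]\<close> were shorter than \<open>v\<close>, moving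
      \<open>k\<close> to the front of \<open>u\<close> would contradict the minimality of
      \<open>v\<close>.\<close>
    have posk: "pos (act v (\<alpha> k))" if k: "k \<in> {i, j}" for k
    proof (rule less.hyps[OF lv], rule ccontr)
      assume "\<not> len v \<le> len (v @ [k])"
      then have lt: "len (v @ [k]) < len v" by simp
      have act: "act ((v @ [k]) @ (k # u)) = act ws" using u by (auto simp: P_def fun_eq_iff)
      have "len (k # u) \<le> Suc (length u)" using len_le[of "k # u" "k # u"] by simp
      then have "len ws \<le> len (v @ [k]) + Suc (length u)"
        using len_append[of "v @ [k]" "k # u"] len_cong[OF act] by simp
      then have "P (v @ [k]) (k # u)" using act u k lt by (auto simp: P_def)
      then show False using min lt by (metis not_le)
    qed
    have setu: "set u \<subseteq> {i, j}" using u by (simp add: P_def)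
    obtain a b where ab: "act u (\<alpha> i) = a *\<^sub>R \<alpha> i + b *\<^sub>R \<alpha> j"
      "a \<ge> 0 \<and> b \<ge> 0 \<or> a \<le> 0 \<and> b \<le> 0"
      using rank2_signs[OF ij setu] by metis
    \<comment> \<open>Otherwise exchange replaces \<open>u @ [i]\<close> by a word shorter than
      \<open>u\<close>, making \<open>ws @ [i]\<close> shorter than \<open>ws\<close>.\<close>
    have "\<not> (a \<le> 0 \<and> b \<le> 0)"
    proof
      assume "a \<le> 0 \<and> b \<le> 0"
      then obtain u' where u': "length u = Suc (length u')" "act u' = act (u @ [i])"
        using rank2_exchange[OF ij setu ab(1)] by blast
      have "act (v @ u') = act (ws @ [i])" using u' u by (auto simp: P_def fun_eq_iff)
      then have "len (ws @ [i]) \<le> len v + length u'"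
        using len_append[of v u'] len_le[of u' u'] len_cong[of "v @ u'" "ws @ [i]"] by simp
      then show False using less.prems u u'(1) by (simp add: P_def)
    qed
    then have "a \<ge> 0" "b \<ge> 0" using ab by auto
    moreover have "act ws (\<alpha> i) = a *\<^sub>R act v (\<alpha> i) + b *\<^sub>R act v (\<alpha> j)"
    proof -
      have "act ws (\<alpha> i) = act v (act u (\<alpha> i))" using u unfolding P_def by (metis act_append)
      then show ?thesis by (simp add: ab(1) act_add act_scale)
    qed
    ultimately show ?thesis using posk by (auto intro: pos_add pos_scale)
  qed
qed

text \<open>If \<open>ws @ [i]\<close> is the shorter element, \<open>pos_of_len_le\<close> applies
  to it instead, and the last reflection turns \<open>\<alpha> i\<close> into its negative.\<close>

lemma sign_coherent: "pos (act ws (\<alpha> i)) \<or> pos (- act ws (\<alpha> i))"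
proof (cases "len ws \<le> len (ws @ [i])")
  case True
  then show ?thesis using pos_of_len_le by blast
next
  case False
  moreover have "act ((ws @ [i]) @ [i]) = act ws" by (auto simp: fun_eq_iff)
  ultimately have "len (ws @ [i]) \<le> len ((ws @ [i]) @ [i])" using len_cong by (metis linear)
  from pos_of_len_le[OF this] show ?thesis by (simp add: s_simple_root act_minus)
qed

text \<open>Removing the last letter \<open>i\<close> of a reduced word changes the difference by a
  nonnegative multiple of \<open>act zs (\<alpha> i)\<close>, which is positive because
  \<open>zs\<close> is shorter than \<open>zs @ [i]\<close>.\<close>

lemma dominant_maximal:
  assumes "\<mu> \<in> fund_chamber \<alpha>v"
  shows "pos (\<mu> - act ws \<mu>)"
proof (induction "len ws" arbitrary: ws rule: less_induct)
  case less
  obtain ys where ys: "length ys = len ws" "act ys = act ws" by (rule len_witness)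
  show ?case
  proof (cases ys rule: rev_cases)
    case Nil
    then show ?thesis using ys(2) by (metis act_Nil diff_self pos_def blinfun.zero_left order_refl)
  next
    case (snoc zs i)
    have "len (zs @ [i]) = len ws" using ys snoc len_cong by blast
    moreover have "len zs \<le> length zs" using len_le by blast
    ultimately have lt: "len zs < len (zs @ [i])" "len zs < len ws" using ys snoc by auto
    have "pos ((\<mu> - act zs \<mu>) + \<mu> (\<alpha>v i) *\<^sub>R act zs (\<alpha> i))"
      using less[OF lt(2)] pos_of_len_le[of zs i] lt assms
      by (intro pos_add pos_scale) (auto simp: fund_chamber_def)
    moreover have "act ws \<mu> = act zs \<mu> - \<mu> (\<alpha>v i) *\<^sub>R act zs (\<alpha> i)"
      using ys(2) snoc by (metis act_Cons act_Nil act_append act_diff act_scale simple_refl_def)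
    ultimately show ?thesis by (simp only: diff_add_eq diff_diff_eq2)
  qed
qed

lemma act_dominant_fixed:
  assumes "set ws \<subseteq> J0 \<alpha>v \<mu>" shows "act ws \<mu> = \<mu>"
  using assms by (induction ws) (auto simp: J0_def simple_refl_def)

section \<open>Coefficients of orbit vectors\<close>

lemma act_diff_expansion:
  "act ws \<eta> - \<eta> = (\<Sum>k\<in>UNIV. (act ws \<eta> - \<eta>) (e k) *\<^sub>R \<alpha> k)"
proof (induction ws)
  case (Cons i ws)
  have "act (i # ws) \<eta> - \<eta> = (act ws \<eta> - \<eta>) - act ws \<eta> (\<alpha>v i) *\<^sub>R \<alpha> i"
    by (simp add: simple_refl_def)
  also have "\<dots> = (\<Sum>k\<in>UNIV. (act ws \<eta> - \<eta>) (e k) *\<^sub>R \<alpha> k) -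
      (\<Sum>k\<in>UNIV. (if k = i then act ws \<eta> (\<alpha>v i) else 0) *\<^sub>R \<alpha> k)"
  proof -
    have "(\<Sum>k\<in>UNIV. (if k = i then act ws \<eta> (\<alpha>v i) else 0) *\<^sub>R \<alpha> k) = act ws \<eta> (\<alpha>v i) *\<^sub>R \<alpha> i"
      by (simp add: if_distrib[of "\<lambda>c. c *\<^sub>R _"] cong: if_cong)
    then show ?thesis by (simp only:) (rule arg_cong2[where f = "(-)", OF Cons HOL.refl])
  qed
  also have "\<dots> = (\<Sum>k\<in>UNIV. (act (i # ws) \<eta> - \<eta>) (e k) *\<^sub>R \<alpha> k)"
    by (auto simp: sum_subtractf[symmetric] scaleR_left_diff_distrib[symmetric] s_apply
        blinfun.diff_left dual_basis intro!: sum.cong)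
  finally show ?case .
qed simp

lemma act_coord_outside:
  assumes "set ws \<subseteq> J" "k \<notin> J" shows "act ws \<eta> (e k) = \<eta> (e k)"
  using assms by (induction ws) (auto simp: s_apply dual_basis)

lemma act_diff_expansion_on:
  assumes "set ws \<subseteq> J"
  shows "act ws \<eta> - \<eta> = (\<Sum>k\<in>J. (act ws \<eta> - \<eta>) (e k) *\<^sub>R \<alpha> k)"
proof -
  have "(\<Sum>k\<in>UNIV. (act ws \<eta> - \<eta>) (e k) *\<^sub>R \<alpha> k) = (\<Sum>k\<in>J. (act ws \<eta> - \<eta>) (e k) *\<^sub>R \<alpha> k)"
    by (rule sum.mono_neutral_right) (auto simp: blinfun.diff_left act_coord_outside[OF assms])
  then show ?thesis using act_diff_expansion[of ws \<eta>] by simp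
qed

lemma act_coord_Ints:
  fixes \<eta> :: "'h \<Rightarrow>\<^sub>L real"
  assumes "set ws \<subseteq> J" "\<And>i. i \<in> J \<Longrightarrow> \<eta> (\<alpha>v i) \<in> \<int>"
  shows "(act ws \<eta> - \<eta>) (e k) \<in> \<int>"
proof -
  have "(act ws \<eta> - \<eta>) (e k) \<in> \<int> \<and> (\<forall>i\<in>J. act ws \<eta> (\<alpha>v i) \<in> \<int>)"
    using assms(1)
  proof (induction ws)
    case Nil
    then show ?case using assms(2) by simp
  next
    case (Cons i ws)
    then have IH: "(act ws \<eta> - \<eta>) (e k) \<in> \<int>" "\<forall>i\<in>J. act ws \<eta> (\<alpha>v i) \<in> \<int>" "i \<in> J" by auto
    have "(act (i # ws) \<eta> - \<eta>) (e k) = (act ws \<eta> - \<eta>) (e k) - act ws \<eta> (\<alpha>v i) * \<alpha> i (e k)"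
      by (simp add: blinfun.diff_left s_apply)
    moreover have "blinfun_apply (\<alpha> i) (e k) \<in> \<int>" by (simp add: dual_basis)
    ultimately have "(act (i # ws) \<eta> - \<eta>) (e k) \<in> \<int>" using IH by auto
    moreover have "act (i # ws) \<eta> (\<alpha>v j) \<in> \<int>" if "j \<in> J" for j
      using IH cartan_Ints that by (auto simp: s_apply pairing)
    ultimately show ?case by blast
  qed
  then show ?thesis ..
qed

text \<open>
  If \<open>d\<close> symmetrizes \<open>A\<close> on \<open>J\<close>, this is the invariance of the corresponding quadratic form,
  written as \<open>(\<beta> - \<eta>, \<beta> + \<eta>) = 0\<close> for \<open>\<beta>\<close> in the orbit of \<open>\<eta>\<close>.
\<close>

lemma act_form_invariant:
  fixes d :: "'n \<Rightarrow> real"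
  assumes "set ws \<subseteq> J" and ds: "\<And>i j. i \<in> J \<Longrightarrow> j \<in> J \<Longrightarrow> d i * A $ i $ j = d j * A $ j $ i"
  shows "(\<Sum>k\<in>J. d k * (act ws \<eta> - \<eta>) (e k) * (act ws \<eta> + \<eta>) (\<alpha>v k)) = 0"
  using assms(1)
proof (induction ws)
  case (Cons i ws)
  then have i: "i \<in> J" and IH: "(\<Sum>k\<in>J. d k * (act ws \<eta> - \<eta>) (e k) * (act ws \<eta> + \<eta>) (\<alpha>v k)) = 0"
    and ws: "set ws \<subseteq> J" by auto
  define \<beta> where "\<beta> = act ws \<eta>"
  define t where "t = \<beta> (\<alpha>v i)"
  define c where "c k = (\<beta> - \<eta>) (e k)" for k
  have "\<beta> - \<eta> = (\<Sum>k\<in>J. c k *\<^sub>R \<alpha> k)"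
    using act_diff_expansion_on[OF ws, of \<eta>] unfolding \<beta>_def c_def .
  then have "(\<beta> - \<eta>) (\<alpha>v i) = (\<Sum>k\<in>J. c k * A $ i $ k)"
    by (simp only: blinfun.sum_left blinfun.scaleR_left pairing real_scaleR_def)
  \<comment> \<open>Symmetry under \<open>d\<close> turns the column sum into a row sum, that is,
    into a value at the coroot of \<open>i\<close>.\<close>
  then have key: "(\<Sum>k\<in>J. d k * c k * A $ k $ i) = d i * (\<beta> - \<eta>) (\<alpha>v i)"
    using ds[OF i] by (simp add: sum_distrib_left) (rule sum.cong, auto simp: mult_ac)
  have "(\<Sum>k\<in>J. d k * (s i \<beta> - \<eta>) (e k) * (s i \<beta> + \<eta>) (\<alpha>v k)) =
      (\<Sum>k\<in>J. d k * c k * (\<beta> + \<eta>) (\<alpha>v k) - t * (d k * c k * A $ k $ i)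
        - (if k = i then d i * t * ((\<beta> + \<eta>) (\<alpha>v i) - t * 2) else 0))"
    by (rule sum.cong)
       (auto simp: s_apply blinfun.diff_left blinfun.add_left pairing dual_basis t_def c_def cartan_diag algebra_simps)
  also have "\<dots> = (\<Sum>k\<in>J. d k * c k * (\<beta> + \<eta>) (\<alpha>v k)) - t * (\<Sum>k\<in>J. d k * c k * A $ k $ i)
        - d i * t * ((\<beta> + \<eta>) (\<alpha>v i) - t * 2)"
    using i by (simp add: sum_subtractf sum_distrib_left)
  also have "\<dots> = 0"
  proof -
    have "(\<Sum>k\<in>J. d k * c k * (\<beta> + \<eta>) (\<alpha>v k)) = 0" using IH unfolding c_def \<beta>_def .
    then show ?thesis
      unfolding key by (simp add: t_def blinfun.add_left blinfun.diff_left algebra_simps)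
  qed
  finally show ?case by (simp add: \<beta>_def)
qed simp

text \<open>The coefficients of \<open>act ws \<eta> - \<eta>\<close> are integers, and the
  invariant form, positive definite here, bounds them.\<close>

lemma finite_integral_orbit:
  fixes \<eta> :: "'h \<Rightarrow>\<^sub>L real"
  assumes ft: "\<And>C. C \<in> conn_comps A J \<Longrightarrow> finite_type A C"
    and int: "\<And>i. i \<in> J \<Longrightarrow> \<eta> (\<alpha>v i) \<in> \<int>"
  shows "finite {act ws \<eta> | ws. set ws \<subseteq> J}"
proof -
  obtain d u :: "'n \<Rightarrow> real" where d: "\<And>i. i \<in> J \<Longrightarrow> d i > 0" and u: "\<And>i. i \<in> J \<Longrightarrow> u i > 0"
    and Au: "\<And>i. i \<in> J \<Longrightarrow> sub_mult A J u i > 0"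
    and ds: "\<And>i j. i \<in> J \<Longrightarrow> j \<in> J \<Longrightarrow> d i * A $ i $ j = d j * A $ j $ i"
    using finite_type_weights[OF ft] by metis
  define m where "m i = d i * (sub_mult A J u i / u i)" for i
  define l where "l i = d i * \<eta> (\<alpha>v i)" for i
  define M where "M = (\<Sum>i\<in>J. (l i)\<^sup>2 / m i)"
  have m: "m i > 0" if "i \<in> J" for i using d u Au that by (simp add: m_def)
  define N where "N = (\<Sum>i\<in>J. (2 * \<bar>l i\<bar> + M) / m i + 1)"
  have M0: "M \<ge> 0" unfolding M_def by (intro sum_nonneg divide_nonneg_nonneg) (auto simp: less_imp_le m)
  have bound: "\<bar>(act ws \<eta> - \<eta>) (e k)\<bar> \<le> N" if ws: "set ws \<subseteq> J" and k: "k \<in> J" for ws k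
  proof -
    define c where "c i = (act ws \<eta> - \<eta>) (e i)" for i
    have val: "(act ws \<eta> - \<eta>) (\<alpha>v i) = sub_mult A J c i" for i
    proof -
      have "(act ws \<eta> - \<eta>) (\<alpha>v i) = (\<Sum>k\<in>J. c k *\<^sub>R \<alpha> k) (\<alpha>v i)"
        unfolding c_def by (rule arg_cong[where f = "\<lambda>x. blinfun_apply x (\<alpha>v i)", OF act_diff_expansion_on[OF ws]])
      then show ?thesis by (simp add: sub_mult_def blinfun.sum_left blinfun.scaleR_left pairing mult.commute)
    qed
    have "(\<Sum>i\<in>J. m i * (c i)\<^sup>2) \<le> (\<Sum>i\<in>J. d i * c i * sub_mult A J c i)"
      unfolding m_def by (rule symmetrized_form_ge[OF d u ds])
    moreover have "(\<Sum>i\<in>J. d i * c i * sub_mult A J c i + 2 * l i * c i) = 0"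
    proof -
      have "d i * c i * sub_mult A J c i + 2 * l i * c i
          = d i * (act ws \<eta> - \<eta>) (e i) * (act ws \<eta> + \<eta>) (\<alpha>v i)" for i
        unfolding val[symmetric] by (simp add: l_def c_def blinfun.add_left blinfun.diff_left algebra_simps)
      then show ?thesis using act_form_invariant[OF ws ds, of \<eta>] by simp
    qed
    ultimately have le0: "(\<Sum>i\<in>J. m i * (c i)\<^sup>2 + 2 * l i * c i) \<le> 0" by (simp add: sum.distrib)
    \<comment> \<open>Completing the square bounds every summand below, so \<open>le0\<close> leaves
      at most \<open>M\<close> for the single summand at \<open>k\<close>.\<close>
    have ge: "m i * (c i)\<^sup>2 + 2 * l i * c i \<ge> - ((l i)\<^sup>2 / m i)" if "i \<in> J" for i
    proof -
      have "m i * (c i)\<^sup>2 + 2 * l i * c i + (l i)\<^sup>2 / m i = (m i * c i + l i)\<^sup>2 / m i"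
        using m[OF that] by (simp add: power2_eq_square field_simps)
      also have "\<dots> \<ge> 0" using m[OF that] by simp
      finally show ?thesis by linarith
    qed
    have "(\<Sum>i\<in>J. m i * (c i)\<^sup>2 + 2 * l i * c i) =
        m k * (c k)\<^sup>2 + 2 * l k * c k + (\<Sum>i\<in>J - {k}. m i * (c i)\<^sup>2 + 2 * l i * c i)"
      using k by (intro sum.remove) auto
    moreover have "(\<Sum>i\<in>J - {k}. m i * (c i)\<^sup>2 + 2 * l i * c i) \<ge> (\<Sum>i\<in>J - {k}. - ((l i)\<^sup>2 / m i))"
      using ge by (intro sum_mono) auto
    moreover have "(\<Sum>i\<in>J - {k}. (l i)\<^sup>2 / m i) \<le> M"
      unfolding M_def using m by (intro sum_mono2) (auto intro: divide_nonneg_pos)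
    ultimately have "m k * (c k)\<^sup>2 + 2 * l k * c k \<le> M" using le0 by (simp add: sum_negf)
    then have "\<bar>c k\<bar> \<le> (2 * \<bar>l k\<bar> + M) / m k + 1" by (rule quadratic_bounded[OF m[OF k] M0])
    also have "\<dots> \<le> N"
      unfolding N_def using k m M0
      by (intro member_le_sum[where f = "\<lambda>i. (2 * \<bar>l i\<bar> + M) / m i + 1"]) (auto intro!: add_nonneg_nonneg divide_nonneg_pos)
    finally show ?thesis by (simp add: c_def)
  qed
  have "{act ws \<eta> | ws. set ws \<subseteq> J} \<subseteq>
      (\<lambda>c. \<eta> + (\<Sum>k\<in>J. c k *\<^sub>R \<alpha> k)) ` (PiE J (\<lambda>_. real_of_int ` {- \<lceil>N\<rceil>..\<lceil>N\<rceil>}))"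
  proof clarify
    fix ws assume ws: "set ws \<subseteq> J"
    let ?c = "restrict (\<lambda>k. (act ws \<eta> - \<eta>) (e k)) J"
    have "?c \<in> PiE J (\<lambda>_. real_of_int ` {- \<lceil>N\<rceil>..\<lceil>N\<rceil>})"
    proof (rule restrict_PiE_iff[THEN iffD2], rule ballI)
      fix k assume k: "k \<in> J"
      obtain z where z: "(act ws \<eta> - \<eta>) (e k) = of_int z"
        using act_coord_Ints[of ws J \<eta> k, OF ws int] Ints_cases by blast
      then have "\<bar>of_int z\<bar> \<le> N" using bound[OF ws k] by simp
      then have "z \<in> {- \<lceil>N\<rceil>..\<lceil>N\<rceil>}" by (simp, linarith)
      then show "(act ws \<eta> - \<eta>) (e k) \<in> real_of_int ` {- \<lceil>N\<rceil>..\<lceil>N\<rceil>}" using z by blast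
    qed
    moreover have "act ws \<eta> = \<eta> + (\<Sum>k\<in>J. ?c k *\<^sub>R \<alpha> k)"
      using act_diff_expansion_on[OF ws, of \<eta>] by (simp add: algebra_simps)
    ultimately show "act ws \<eta> \<in> (\<lambda>c. \<eta> + (\<Sum>k\<in>J. c k *\<^sub>R \<alpha> k)) ` (PiE J (\<lambda>_. real_of_int ` {- \<lceil>N\<rceil>..\<lceil>N\<rceil>}))"
      by (intro image_eqI[where x = ?c])
  qed
  then show ?thesis by (rule finite_subset) (intro finite_imageI finite_PiE, auto)
qed

subsection \<open>The orbit hull near the dominant vertex\<close>

text \<open>\<open>pos\<close> sees only values at the vectors \<open>e k\<close>; the expansion
  clause places the element in the cone spanned by the simple roots.\<close>

definition root_cone :: "('h \<Rightarrow>\<^sub>L real) set" where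
  "root_cone = {\<eta>. pos \<eta> \<and> \<eta> = (\<Sum>k\<in>UNIV. \<eta> (e k) *\<^sub>R \<alpha> k)}"

text \<open>Both conditions survive convex combinations, so they are checked on the orbit, where the
  first comes from \<open>dominant_maximal\<close> and \<open>act_diff_expansion\<close>.\<close>

lemma orbit_hull_act:
  assumes dom: "\<mu> \<in> fund_chamber \<alpha>v" and x: "x \<in> orbit_hull \<alpha> \<alpha>v \<mu>"
  shows "\<mu> - act ws x \<in> root_cone" "k \<notin> Pi_star A (J0 \<alpha>v \<mu>) \<Longrightarrow> (\<mu> - act ws x) (e k) = 0"
proof -
  let ?P = "Pi_star A (J0 \<alpha>v \<mu>)"
  define S where "S = {y. \<mu> - act ws y \<in> root_cone \<and> (\<forall>k. k \<notin> ?P \<longrightarrow> (\<mu> - act ws y) (e k) = 0)}"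
  have "convex S"
  proof (rule convexI)
    fix y z :: "'h \<Rightarrow>\<^sub>L real" and a b :: real
    assume yz: "y \<in> S" "z \<in> S" and ab: "0 \<le> a" "0 \<le> b" "a + b = 1"
    let ?y = "\<mu> - act ws y" and ?z = "\<mu> - act ws z"
    have eq: "\<mu> - act ws (a *\<^sub>R y + b *\<^sub>R z) = a *\<^sub>R ?y + b *\<^sub>R ?z"
    proof -
      have "\<mu> = a *\<^sub>R \<mu> + b *\<^sub>R \<mu>" using ab(3) by (metis scaleR_left_distrib scaleR_one)
      then show ?thesis by (simp add: act_add act_scale scaleR_right_diff_distrib)
    qed
    have "a *\<^sub>R ?y + b *\<^sub>R ?z = (\<Sum>k\<in>UNIV. (a *\<^sub>R ?y + b *\<^sub>R ?z) (e k) *\<^sub>R \<alpha> k)"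
    proof -
      have "?y = (\<Sum>k\<in>UNIV. ?y (e k) *\<^sub>R \<alpha> k)" "?z = (\<Sum>k\<in>UNIV. ?z (e k) *\<^sub>R \<alpha> k)"
        using yz by (auto simp: S_def root_cone_def)
      then have "a *\<^sub>R ?y + b *\<^sub>R ?z = a *\<^sub>R (\<Sum>k\<in>UNIV. ?y (e k) *\<^sub>R \<alpha> k) + b *\<^sub>R (\<Sum>k\<in>UNIV. ?z (e k) *\<^sub>R \<alpha> k)"
        by metis
      also have "\<dots> = (\<Sum>k\<in>UNIV. (a *\<^sub>R ?y + b *\<^sub>R ?z) (e k) *\<^sub>R \<alpha> k)"
        by (simp add: scaleR_sum_right blinfun.add_left blinfun.scaleR_left scaleR_left_distrib sum.distrib)
      finally show ?thesis .
    qed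
    moreover have "pos (a *\<^sub>R ?y + b *\<^sub>R ?z)"
      using yz ab by (auto simp: S_def root_cone_def intro!: pos_add pos_scale)
    moreover have "(a *\<^sub>R ?y + b *\<^sub>R ?z) (e k) = 0" if "k \<notin> ?P" for k
      using yz that unfolding S_def by (simp add: blinfun.add_left blinfun.scaleR_left)
    ultimately show "a *\<^sub>R y + b *\<^sub>R z \<in> S" unfolding S_def mem_Collect_eq eq root_cone_def by blast
  qed
  moreover have "act ys \<mu> \<in> S" for ys
  proof -
    define \<delta> where "\<delta> = act (ws @ ys) \<mu> - \<mu>"
    have flip: "\<mu> - act (ws @ ys) \<mu> = - \<delta>" by (simp add: \<delta>_def)
    have "\<delta> = (\<Sum>k\<in>UNIV. \<delta> (e k) *\<^sub>R \<alpha> k)"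
      unfolding \<delta>_def by (rule act_diff_expansion)
    then have "- \<delta> = (\<Sum>k\<in>UNIV. (- \<delta>) (e k) *\<^sub>R \<alpha> k)"
      unfolding blinfun.minus_left scaleR_minus_left sum_negf by (rule arg_cong)
    then have "\<mu> - act (ws @ ys) \<mu> = (\<Sum>k\<in>UNIV. (\<mu> - act (ws @ ys) \<mu>) (e k) *\<^sub>R \<alpha> k)"
      unfolding flip .
    moreover have "(\<mu> - act zs \<mu>) (e k) = 0" if k: "k \<notin> ?P" for zs k
    proof -
      \<comment> \<open>The induction also carries that \<open>act zs \<mu>\<close> vanishes at
        coroots outside \<open>?P\<close>: reflections outside \<open>?P\<close> then fix the
        vector, and those inside touch no outer coefficient.\<close>
      have "(\<mu> - act zs \<mu>) (e k) = 0 \<and> (\<forall>j. j \<notin> ?P \<longrightarrow> act zs \<mu> (\<alpha>v j) = 0)"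
      proof (induction zs)
        case Nil
        then show ?case using Pi_star_outside[of _ "J0 \<alpha>v \<mu>"] by (auto simp: J0_def)
      next
        case (Cons i zs)
        show ?case
        proof (cases "i \<in> ?P")
          case True
          then have "A $ j $ i = 0" if "j \<notin> ?P" for j
            using Pi_star_closed[of i _ j] cartan_zero[of i j] that by blast
          then show ?thesis using Cons True k by (auto simp: s_apply pairing dual_basis blinfun.diff_left)
        next
          case False
          then have "s i (act zs \<mu>) = act zs \<mu>" using Cons by (simp add: simple_refl_def)
          then show ?thesis using Cons by simp
        qed
      qed
      then show ?thesis ..
    qed
    ultimately show ?thesis
      using dominant_maximal[OF dom, of "ws @ ys"]
      unfolding S_def root_cone_def mem_Collect_eq act_append[symmetric] by blast
  qed
  ultimately have "orbit_hull \<alpha> \<alpha>v \<mu> \<subseteq> S"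
    unfolding orbit_hull_def weyl_group_eq by (intro hull_minimal) auto
  then show "\<mu> - act ws x \<in> root_cone" "k \<notin> ?P \<Longrightarrow> (\<mu> - act ws x) (e k) = 0"
    using x unfolding S_def by blast+
qed

lemma act_in_orbit_hull: "act ws \<mu> \<in> orbit_hull \<alpha> \<alpha>v \<mu>"
  unfolding orbit_hull_def weyl_group_eq by (rule hull_inc) blast

subsection \<open>Edges at the dominant vertex\<close>

lemma root_multiplicity_one:
  assumes "set ws \<subseteq> J" "j \<notin> J" shows "act ws (\<alpha> j) (e j) = 1"
  using act_coord_outside[OF assms] by (simp add: dual_basis)

lemma act_simple_reflection:
  assumes "set ws \<subseteq> J0 \<alpha>v \<mu>"
  shows "act ws (s j \<mu>) = \<mu> - \<mu> (\<alpha>v j) *\<^sub>R act ws (\<alpha> j)"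
  by (simp add: simple_refl_def act_diff act_scale act_dominant_fixed[OF assms])

text \<open>The element \<open>act (rev ws)\<close> fixes \<open>\<mu>\<close> and carries the line
  to direction \<open>\<alpha> j\<close>. The sum \<open>\<psi>\<close> of the other coefficients is
  affine, nonnegative on the hull, and zero exactly on the proposed edge, which is therefore a face.
  The point \<open>act ws (s j \<mu>)\<close> keeps it from collapsing to a vertex.\<close>

lemma edge_along_root:
  assumes dom: "\<mu> \<in> fund_chamber \<alpha>v" and ws: "set ws \<subseteq> J0 \<alpha>v \<mu>" and j: "j \<notin> J0 \<alpha>v \<mu>"
  shows "edge_in {x \<in> orbit_hull \<alpha> \<alpha>v \<mu>. \<exists>t. x = \<mu> - t *\<^sub>R act ws (\<alpha> j)} (orbit_hull \<alpha> \<alpha>v \<mu>)"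
proof -
  let ?H = "orbit_hull \<alpha> \<alpha>v \<mu>" and ?g = "act ws (\<alpha> j)"
  let ?E = "{x \<in> ?H. \<exists>t. x = \<mu> - t *\<^sub>R ?g}"
  define \<psi> where "\<psi> x = (\<Sum>k\<in>- {j}. (\<mu> - act (rev ws) x) (e k))" for x
  have rws: "set (rev ws) \<subseteq> J0 \<alpha>v \<mu>" using ws by simp
  have conv: "convex ?H" unfolding orbit_hull_def by (rule convex_convex_hull)
  have term_nonneg: "(\<mu> - act (rev ws) x) (e k) \<ge> 0" if "x \<in> ?H" for x k
    using orbit_hull_act(1)[OF dom that, of "rev ws"] by (simp add: root_cone_def pos_def)
  have nonneg: "\<psi> x \<ge> 0" if "x \<in> ?H" for x
    unfolding \<psi>_def using term_nonneg[OF that] by (rule sum_nonneg)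
  have affine: "\<psi> ((1 - u) *\<^sub>R x + u *\<^sub>R y) = (1 - u) * \<psi> x + u * \<psi> y" for u x y
  proof -
    have "(\<mu> - act (rev ws) ((1 - u) *\<^sub>R x + u *\<^sub>R y)) (e k) =
        (1 - u) * (\<mu> - act (rev ws) x) (e k) + u * (\<mu> - act (rev ws) y) (e k)" for k
      by (simp only: act_add act_scale blinfun.diff_left blinfun.add_left blinfun.scaleR_left real_scaleR_def)
         (simp add: algebra_simps)
    then show ?thesis by (simp add: \<psi>_def sum.distrib sum_distrib_left)
  qed
  have E: "x \<in> ?E \<longleftrightarrow> \<psi> x = 0" if x: "x \<in> ?H" for x
  proof
    assume "x \<in> ?E"
    then obtain t where "x = \<mu> - t *\<^sub>R ?g" by blast
    then have "\<mu> - act (rev ws) x = t *\<^sub>R \<alpha> j"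
      by (simp add: act_diff act_scale act_dominant_fixed[OF rws])
    then show "\<psi> x = 0" by (simp add: \<psi>_def blinfun.scaleR_left dual_basis)
  next
    assume 0: "\<psi> x = 0"
    let ?y = "\<mu> - act (rev ws) x"
    have zero: "?y (e k) = 0" if "k \<noteq> j" for k
      using 0 sum_nonneg_eq_0_iff[of "- {j}" "\<lambda>k. ?y (e k)"] term_nonneg[OF x] that
      unfolding \<psi>_def by auto
    have "?y = (\<Sum>k\<in>UNIV. ?y (e k) *\<^sub>R \<alpha> k)"
      using orbit_hull_act(1)[OF dom x] by (simp add: root_cone_def)
    also have "\<dots> = (\<Sum>k\<in>{j}. ?y (e k) *\<^sub>R \<alpha> k)"
      by (rule sum.mono_neutral_right) (use zero in auto)
    finally have "?y = ?y (e j) *\<^sub>R \<alpha> j" by simp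
    then have "act ws ?y = ?y (e j) *\<^sub>R ?g" by (metis act_scale)
    then have "x = \<mu> - ?y (e j) *\<^sub>R ?g"
      by (simp add: act_diff act_dominant_fixed[OF ws] algebra_simps)
    then show "x \<in> ?E" using x by blast
  qed
  have "?E face_of ?H"
    unfolding face_of_def
  proof (intro conjI ballI impI)
    show "?E \<subseteq> ?H" by blast
    show "convex ?E"
      unfolding convex_alt
    proof (intro ballI allI impI)
      fix x y :: "'h \<Rightarrow>\<^sub>L real" and u :: real
      assume xy: "x \<in> ?E" "y \<in> ?E" and u: "0 \<le> u \<and> u \<le> 1"
      then have "(1 - u) *\<^sub>R x + u *\<^sub>R y \<in> ?H" using conv unfolding convex_alt by blast
      moreover have "\<psi> x = 0" "\<psi> y = 0" using E xy by blast+
      ultimately show "(1 - u) *\<^sub>R x + u *\<^sub>R y \<in> ?E" using E affine by simp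
    qed
    fix x y z assume xy: "x \<in> ?H" "y \<in> ?H" and z: "z \<in> ?E" "z \<in> open_segment x y"
    from z(2) obtain u where u: "0 < u" "u < 1" "z = (1 - u) *\<^sub>R x + u *\<^sub>R y" unfolding in_segment by blast
    have "\<psi> z = 0" using E z(1) by blast
    then have "(1 - u) * \<psi> x + u * \<psi> y = 0" unfolding u(3) affine .
    moreover have "(1 - u) * \<psi> x \<ge> 0" "u * \<psi> y \<ge> 0" using u nonneg[OF xy(1)] nonneg[OF xy(2)] by auto
    ultimately have "(1 - u) * \<psi> x = 0" "u * \<psi> y = 0" by linarith+
    then have "\<psi> x = 0" "\<psi> y = 0" using u by auto
    then show "x \<in> ?E" "y \<in> ?E" using E xy by blast+
  qed
  moreover have mu: "\<mu> \<in> ?E" using act_in_orbit_hull[of "[]" \<mu>] by (auto intro: exI[of _ 0])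
  moreover have "dim {x - y | x y. x \<in> ?E \<and> y \<in> ?E} = 1"
  proof (rule dim_unique)
    let ?m = "\<mu> (\<alpha>v j)"
    have m: "?m \<noteq> 0" using j by (simp add: J0_def)
    have g0: "?g \<noteq> 0" using root_multiplicity_one[OF ws j] by auto
    have "act ws (s j \<mu>) \<in> ?H" using act_in_orbit_hull[of "ws @ [j]" \<mu>] by simp
    then have "act ws (s j \<mu>) \<in> ?E" using act_simple_reflection[OF ws] by blast
    then have "\<mu> - act ws (s j \<mu>) \<in> {x - y | x y. x \<in> ?E \<and> y \<in> ?E}" using mu by blast
    then show "{?m *\<^sub>R ?g} \<subseteq> {x - y | x y. x \<in> ?E \<and> y \<in> ?E}"
      unfolding act_simple_reflection[OF ws] by simp
    show "independent {?m *\<^sub>R ?g}" using m g0 by simp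
    show "{x - y | x y. x \<in> ?E \<and> y \<in> ?E} \<subseteq> span {?m *\<^sub>R ?g}"
    proof clarify
      fix t r :: real
      have "(\<mu> - t *\<^sub>R ?g) - (\<mu> - r *\<^sub>R ?g) = ((r - t) / ?m) *\<^sub>R (?m *\<^sub>R ?g)"
        using m by (simp add: scaleR_left_diff_distrib)
      then show "(\<mu> - t *\<^sub>R ?g) - (\<mu> - r *\<^sub>R ?g) \<in> span {?m *\<^sub>R ?g}"
        by (simp only:) (intro span_scale span_base singletonI)
    qed
  qed simp
  ultimately show ?thesis unfolding edge_in_def by blast
qed

text \<open>Different roots in the orbit give different edges: each has coefficient 1 at
  \<open>\<alpha> j\<close>, so proportional ones coincide.\<close>

lemma finite_orbit_if_finite_edges:
  assumes dom: "\<mu> \<in> fund_chamber \<alpha>v" and j: "j \<notin> J0 \<alpha>v \<mu>"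
    and fin: "finite {E. edge_in E (orbit_hull \<alpha> \<alpha>v \<mu>) \<and> \<mu> \<in> E}"
  shows "finite {act ws (\<alpha> j) | ws. set ws \<subseteq> J0 \<alpha>v \<mu>}"
proof -
  let ?H = "orbit_hull \<alpha> \<alpha>v \<mu>"
  let ?O = "{act ws (\<alpha> j) | ws. set ws \<subseteq> J0 \<alpha>v \<mu>}"
  let ?F = "\<lambda>g. {x \<in> ?H. \<exists>t. x = \<mu> - t *\<^sub>R g}"
  have "?F ` ?O \<subseteq> {E. edge_in E ?H \<and> \<mu> \<in> E}"
    using edge_along_root[OF dom _ j] act_in_orbit_hull[of "[]" \<mu>] by (auto intro: exI[of _ 0])
  moreover have "inj_on ?F ?O"
  proof (rule inj_onI, clarify)
    fix ws ys assume ws: "set ws \<subseteq> J0 \<alpha>v \<mu>" and ys: "set ys \<subseteq> J0 \<alpha>v \<mu>"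
      and eq: "?F (act ws (\<alpha> j)) = ?F (act ys (\<alpha> j))"
    have "act ws (s j \<mu>) \<in> ?H" using act_in_orbit_hull[of "ws @ [j]" \<mu>] by simp
    then have "act ws (s j \<mu>) \<in> ?F (act ws (\<alpha> j))" using act_simple_reflection[OF ws] by blast
    then have "act ws (s j \<mu>) \<in> ?F (act ys (\<alpha> j))" unfolding eq .
    then obtain t where "act ws (s j \<mu>) = \<mu> - t *\<^sub>R act ys (\<alpha> j)" by blast
    then have t: "\<mu> (\<alpha>v j) *\<^sub>R act ws (\<alpha> j) = t *\<^sub>R act ys (\<alpha> j)"
      unfolding act_simple_reflection[OF ws] by simp
    then have "(\<mu> (\<alpha>v j) *\<^sub>R act ws (\<alpha> j)) (e j) = (t *\<^sub>R act ys (\<alpha> j)) (e j)" by simp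
    then have "t = \<mu> (\<alpha>v j)"
      by (simp add: blinfun.scaleR_left root_multiplicity_one[OF ws j] root_multiplicity_one[OF ys j])
    then show "act ws (\<alpha> j) = act ys (\<alpha> j)" using t j by (simp add: J0_def)
  qed
  ultimately show ?thesis using fin finite_subset finite_imageD by meson
qed

text \<open>The sum of a finite orbit is an invariant vector, whose coefficients certify finite type.\<close>

lemma finite_type_of_finite_orbits:
  assumes orb: "\<And>j. j \<notin> J \<Longrightarrow> finite {act ws (\<alpha> j) | ws. set ws \<subseteq> J}"
    and C: "C \<in> conn_comps A (Pi_star A J \<inter> J)"
  shows "finite_type A C"
proof -
  obtain i j where ij: "i \<in> C" "j \<notin> J" "A $ i $ j \<noteq> 0" using comp_has_outer_neighbour[OF C] .
  let ?O = "{act ws (\<alpha> j) | ws. set ws \<subseteq> J}"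
  have CJ: "C \<subseteq> J" "C \<subseteq> Pi_star A J" using conn_comp_subset[OF C] by auto
  define S where "S = \<Sum>?O"
  define c where "c k = S (e k)" for k
  have fin: "finite ?O" using orb[OF ij(2)] .
  have "\<alpha> j \<in> ?O" by (intro CollectI exI[of _ "[]"]) simp
  then have card: "card ?O > 0" using fin by (auto simp: card_gt_0_iff)
  \<comment> \<open>Reflections in \<open>J\<close> permute the orbit and fix its sum, hence the sum
    vanishes at the coroots of \<open>J\<close>.\<close>
  have inv: "S (\<alpha>v k) = 0" if k: "k \<in> J" for k
  proof -
    have sO: "s k g \<in> ?O" if g: "g \<in> ?O" for g
    proof -
      obtain ws where "g = act ws (\<alpha> j)" "set ws \<subseteq> J" using g by blast
      then show ?thesis using k by (intro CollectI exI[of _ "k # ws"]) auto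
    qed
    have "s k S = (\<Sum>g\<in>?O. s k g)" unfolding S_def using linear_sum[OF linear_s] by blast
    also have "\<dots> = S"
      unfolding S_def by (rule sum.reindex_bij_witness[where i = "s k" and j = "s k"]) (use sO in auto)
    finally have "S (e k) - S (\<alpha>v k) * \<alpha> k (e k) = S (e k)" by (metis s_apply)
    then show ?thesis by (simp add: dual_basis)
  qed
  have gval: "g (\<alpha>v i) = A $ i $ j + (\<Sum>k\<in>J. g (e k) * A $ i $ k)" if g: "g \<in> ?O" for g i
  proof -
    obtain ws where ws: "g = act ws (\<alpha> j)" "set ws \<subseteq> J" using g by blast
    have "g - \<alpha> j = (\<Sum>k\<in>J. (g - \<alpha> j) (e k) *\<^sub>R \<alpha> k)"
      unfolding ws(1) by (rule act_diff_expansion_on[OF ws(2)])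
    also have "\<dots> = (\<Sum>k\<in>J. g (e k) *\<^sub>R \<alpha> k)"
      by (rule sum.cong) (use ij(2) in \<open>auto simp: blinfun.diff_left dual_basis\<close>)
    finally have "(g - \<alpha> j) (\<alpha>v i) = (\<Sum>k\<in>J. g (e k) *\<^sub>R \<alpha> k) (\<alpha>v i)" by (rule arg_cong)
    then show ?thesis by (simp add: blinfun.diff_left blinfun.sum_left blinfun.scaleR_left pairing)
  qed
  \<comment> \<open>Coefficient 1 at \<open>\<alpha> j\<close> selects the positive alternative of
    sign coherence.\<close>
  have gpos: "g (e k) \<ge> 0" if g: "g \<in> ?O" for g k
  proof -
    obtain ws where ws: "g = act ws (\<alpha> j)" "set ws \<subseteq> J" using g by blast
    have "\<not> pos (- act ws (\<alpha> j))"
      using root_multiplicity_one[OF ws(2) ij(2)] by (auto simp: pos_def blinfun.minus_left intro: exI[of _ j])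
    then show ?thesis using sign_coherent[of ws j] ws(1) by (auto simp: pos_def)
  qed
  have c_nonneg: "c k \<ge> 0" for k
    unfolding c_def S_def blinfun.sum_left using gpos by (rule sum_nonneg)
  \<comment> \<open>Vanishing of \<open>S\<close> at the coroot of \<open>p\<close> is a linear
    equation for \<open>c\<close>. Neighbours of \<open>p\<close> in \<open>J\<close> lie in
    \<open>C\<close>, so only the block of \<open>C\<close> remains, with the contribution of
    \<open>\<alpha> j\<close> moved to the other side.\<close>
  have val: "sub_mult A C c p = - (real (card ?O) * A $ p $ j)" if p: "p \<in> C" for p
  proof -
    have "0 = S (\<alpha>v p)" using inv CJ p by auto
    also have "\<dots> = (\<Sum>g\<in>?O. A $ p $ j + (\<Sum>k\<in>J. blinfun_apply g (e k) * A $ p $ k))"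
      unfolding S_def blinfun.sum_left by (rule sum.cong[OF HOL.refl]) (rule gval)
    also have "\<dots> = real (card ?O) * A $ p $ j + (\<Sum>k\<in>J. c k * A $ p $ k)"
      unfolding c_def S_def blinfun.sum_left sum_distrib_right
      by (subst sum.swap[where A = J]) (simp add: sum.distrib)
    also have "(\<Sum>k\<in>J. c k * A $ p $ k) = (\<Sum>k\<in>C. c k * A $ p $ k)"
    proof (rule sum.mono_neutral_right)
      show "\<forall>k\<in>J - C. c k * A $ p $ k = 0"
      proof
        fix k assume k: "k \<in> J - C"
        have "A $ p $ k = 0"
        proof (rule ccontr)
          assume nz: "A $ p $ k \<noteq> 0"
          then have "k \<in> Pi_star A J" using Pi_star_closed CJ p by blast
          then have "k \<in> C" using conn_comp_closed[OF C p _ nz] k by blast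
          then show False using k by blast
        qed
        then show "c k * A $ p $ k = 0" by simp
      qed
    qed (use CJ in auto)
    finally show ?thesis by (simp add: sub_mult_def mult.commute)
  qed
  have nonpos: "A $ p $ j \<le> 0" if "p \<in> C" for p using cartan_offdiag[of p j] that CJ ij(2) by blast
  show ?thesis
  proof (rule finite_typeI[OF conn_comp_indecomposable[OF C] c_nonneg _ ij(1)])
    show "sub_mult A C c p \<ge> 0" if "p \<in> C" for p
      unfolding val[OF that] using nonpos[OF that] by (simp add: mult_nonneg_nonpos)
    have "A $ i $ j < 0" using nonpos[OF ij(1)] ij(3) by simp
    moreover have "real (card ?O) > 0" using card by (simp only: of_nat_0_less_iff)
    ultimately have "real (card ?O) * A $ i $ j < 0" by (rule mult_pos_neg[rotated])
    then show "sub_mult A C c i > 0" unfolding val[OF ij(1)] by (simp only: neg_0_less_iff_less)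
  qed
qed

section \<open>Finite type implies finitely many edges\<close>

text \<open>
  A functional separating the hull from the cone can be made dominant on \<open>J1\<close> by maximizing it over
  the finite orbit of \<open>\<rho>\<close>; it is then nonnegative on all simple roots of \<open>Pi_star\<close>.
\<close>

lemma hull_in_cone:
  fixes \<rho> :: "'h \<Rightarrow>\<^sub>L real"
  assumes dom: "\<mu> \<in> fund_chamber \<alpha>v" and \<rho>: "\<And>i. \<rho> (\<alpha>v i) = 1"
    and J1: "J1 = Pi_star A (J0 \<alpha>v \<mu>) \<inter> J0 \<alpha>v \<mu>"
    and ft: "\<And>C. C \<in> conn_comps A J1 \<Longrightarrow> finite_type A C"
    and P: "P = {act ws (s j \<mu>) | ws j. set ws \<subseteq> J1 \<and> j \<notin> J0 \<alpha>v \<mu>}" "finite P"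
    and x: "x \<in> orbit_hull \<alpha> \<alpha>v \<mu>"
  shows "\<mu> - x \<in> convex_cone hull ((\<lambda>p. \<mu> - p) ` P)"
proof (rule ccontr)
  assume "\<not> ?thesis"
  then obtain a where a: "(\<mu> - x) a < 0" "\<And>p. p \<in> P \<Longrightarrow> (\<mu> - p) a \<ge> 0"
    using separate_convex_cone[of "(\<lambda>p. \<mu> - p) ` P" "\<mu> - x"] P(2) by (metis finite_imageI imageI)
  let ?O = "{act ws \<rho> | ws. set ws \<subseteq> J1}"
  have "finite ?O" by (rule finite_integral_orbit[OF ft]) (auto simp: \<rho>)
  then have fin: "finite ((\<lambda>\<eta>. blinfun_apply \<eta> a) ` ?O)" by simp
  have ne: "(\<lambda>\<eta>. blinfun_apply \<eta> a) ` ?O \<noteq> {}" by (auto intro: exI[of _ "[]"])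
  obtain ws where ws: "set ws \<subseteq> J1" "Max ((\<lambda>\<eta>. blinfun_apply \<eta> a) ` ?O) = act ws \<rho> a"
    using Max_in[OF fin ne] by auto
  have max: "act ys \<rho> a \<le> act ws \<rho> a" if "set ys \<subseteq> J1" for ys
    unfolding ws(2)[symmetric] using that by (intro Max_ge[OF fin]) blast
  have wsJ: "set ws \<subseteq> J0 \<alpha>v \<mu>" using ws J1 by blast
  \<comment> \<open>For \<open>k\<close> in \<open>J1\<close>, maximality is tested against
    \<open>ws @ [k]\<close>, whose value at \<open>a\<close> drops by that of
    \<open>act ws (\<alpha> k)\<close>. For the other \<open>k\<close>, the point
    \<open>act ws (s k \<mu>)\<close> of \<open>P\<close> gives the sign.\<close>
  have root_nonneg: "act ws (\<alpha> k) a \<ge> 0" if k: "k \<in> Pi_star A (J0 \<alpha>v \<mu>)" for k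
  proof (cases "k \<in> J1")
    case True
    then have "act (ws @ [k]) \<rho> a \<le> act ws \<rho> a" using ws(1) by (intro max) auto
    moreover have "act (ws @ [k]) \<rho> = act ws \<rho> - act ws (\<alpha> k)"
      by (simp add: simple_refl_def \<rho> act_diff)
    ultimately show ?thesis by (simp add: blinfun.diff_left)
  next
    case False
    then have kJ: "k \<notin> J0 \<alpha>v \<mu>" using k J1 by blast
    then have "act ws (s k \<mu>) \<in> P" unfolding P(1) using ws(1) by blast
    then have "(\<mu> - act ws (s k \<mu>)) a \<ge> 0" by (rule a(2))
    then have "\<mu> (\<alpha>v k) * act ws (\<alpha> k) a \<ge> 0"
      unfolding act_simple_reflection[OF wsJ] by (simp add: blinfun.scaleR_left)
    moreover have "\<mu> (\<alpha>v k) > 0" using dom kJ by (simp add: fund_chamber_def J0_def less_le)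
    ultimately show ?thesis by (simp add: zero_le_mult_iff)
  qed
  \<comment> \<open>Transporting by \<open>rev ws\<close> and back writes \<open>\<mu> - x\<close>
    as a nonnegative combination of roots \<open>act ws (\<alpha> k)\<close> with \<open>k\<close>
    in \<open>Pi_star\<close>, against the choice of \<open>a\<close>.\<close>
  let ?y = "\<mu> - act (rev ws) x"
  have y: "?y \<in> root_cone" "\<And>k. k \<notin> Pi_star A (J0 \<alpha>v \<mu>) \<Longrightarrow> ?y (e k) = 0"
    using orbit_hull_act[OF dom x] by blast+
  have "?y = (\<Sum>k\<in>UNIV. ?y (e k) *\<^sub>R \<alpha> k)" using y(1) by (simp add: root_cone_def)
  then have "act ws ?y = act ws (\<Sum>k\<in>UNIV. ?y (e k) *\<^sub>R \<alpha> k)" by (rule arg_cong)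
  moreover have "act ws ?y = \<mu> - x" by (simp add: act_diff act_dominant_fixed[OF wsJ])
  ultimately have "(\<mu> - x) a = (\<Sum>k\<in>UNIV. ?y (e k) * act ws (\<alpha> k) a)"
    by (simp only: act_sum act_scale blinfun.sum_left blinfun.scaleR_left real_scaleR_def)
  also have "\<dots> \<ge> 0"
  proof (rule sum_nonneg)
    fix k
    show "?y (e k) * act ws (\<alpha> k) a \<ge> 0"
    proof (cases "k \<in> Pi_star A (J0 \<alpha>v \<mu>)")
      case True
      then show ?thesis using y(1) root_nonneg by (simp add: root_cone_def pos_def)
    next
      case False
      then show ?thesis using y(2) by simp
    qed
  qed
  finally show False using a(1) by simp
qed

text \<open>Every edge at \<open>\<mu>\<close> contains a point of the finite set \<open>P\<close>,
  which avoids \<open>\<mu>\<close>. Two points determine an edge, so choosing such a point is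
  injective.\<close>

lemma finite_edges_if_finite_type:
  fixes \<rho> :: "'h \<Rightarrow>\<^sub>L real"
  assumes dom: "\<mu> \<in> fund_chamber \<alpha>v" and \<rho>: "\<And>i. \<rho> (\<alpha>v i) = 1"
    and ft: "\<And>C. C \<in> conn_comps A (Pi_star A (J0 \<alpha>v \<mu>) \<inter> J0 \<alpha>v \<mu>) \<Longrightarrow> finite_type A C"
  shows "finite {E. edge_in E (orbit_hull \<alpha> \<alpha>v \<mu>) \<and> \<mu> \<in> E}"
proof -
  let ?H = "orbit_hull \<alpha> \<alpha>v \<mu>"
  define J1 where "J1 = Pi_star A (J0 \<alpha>v \<mu>) \<inter> J0 \<alpha>v \<mu>"
  define P where "P = {act ws (s j \<mu>) | ws j. set ws \<subseteq> J1 \<and> j \<notin> J0 \<alpha>v \<mu>}"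
  have J1J: "J1 \<subseteq> J0 \<alpha>v \<mu>" by (auto simp: J1_def)
  have "P \<subseteq> (\<Union>j. (\<lambda>g. \<mu> - \<mu> (\<alpha>v j) *\<^sub>R g) ` {act ws (\<alpha> j) | ws. set ws \<subseteq> J1})"
  proof
    fix p assume "p \<in> P"
    then obtain ws j where ws: "p = act ws (s j \<mu>)" "set ws \<subseteq> J1" unfolding P_def by blast
    then have "p = \<mu> - \<mu> (\<alpha>v j) *\<^sub>R act ws (\<alpha> j)" using act_simple_reflection[of ws \<mu> j] J1J by auto
    then show "p \<in> (\<Union>j. (\<lambda>g. \<mu> - \<mu> (\<alpha>v j) *\<^sub>R g) ` {act ws (\<alpha> j) | ws. set ws \<subseteq> J1})"
      using ws(2) by blast
  qed
  moreover have "finite {act ws (\<alpha> j) | ws. set ws \<subseteq> J1}" for j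
    by (rule finite_integral_orbit) (use ft J1_def in \<open>auto simp: pairing cartan_Ints\<close>)
  ultimately have finP: "finite P" by (auto intro: finite_subset)
  have PH: "P \<subseteq> ?H"
    using act_in_orbit_hull[of "_ @ [_]" \<mu>] by (auto simp: P_def)
  have P_ne: "p \<noteq> \<mu>" if p: "p \<in> P" for p
  proof
    assume eq: "p = \<mu>"
    obtain ws j where ws: "p = act ws (s j \<mu>)" "set ws \<subseteq> J1" "j \<notin> J0 \<alpha>v \<mu>" using p unfolding P_def by blast
    then have "p = \<mu> - \<mu> (\<alpha>v j) *\<^sub>R act ws (\<alpha> j)"
      using act_simple_reflection[of ws \<mu> j] J1J by auto
    then have "\<mu> (\<alpha>v j) *\<^sub>R act ws (\<alpha> j) = 0" using eq by simp
    then have "act ws (\<alpha> j) = 0" using ws(3) by (simp add: J0_def)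
    then show False using root_multiplicity_one[of ws "J0 \<alpha>v \<mu>" j] ws J1J by auto
  qed
  have conv: "convex ?H" unfolding orbit_hull_def by (rule convex_convex_hull)
  have meets: "\<exists>p\<in>P. p \<in> E" if E: "edge_in E ?H" "\<mu> \<in> E" for E
  proof -
    have face: "E face_of ?H" using E by (simp add: edge_in_def)
    have "\<exists>x\<in>E. x \<noteq> \<mu>"
    proof (rule ccontr)
      assume "\<not> ?thesis"
      then have "E = {\<mu>}" using E(2) by blast
      then have "{x - y | x y. x \<in> E \<and> y \<in> E} = {0}" by auto
      moreover have "dim {0 :: 'h \<Rightarrow>\<^sub>L real} = 0" by (rule dim_unique[of "{}"]) (auto simp: independent_empty)
      ultimately show False using E(1) by (simp add: edge_in_def)
    qed
    then obtain x where x: "x \<in> E" "x \<noteq> \<mu>" by blast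
    then have xH: "x \<in> ?H" using face face_of_imp_subset by blast
    have cone: "\<mu> - x \<in> convex_cone hull ((\<lambda>p. \<mu> - p) ` P)"
      using hull_in_cone[OF dom \<rho> J1_def _ P_def finP xH] ft J1_def by simp
    \<comment> \<open>The cone over the empty set is {0}, which \<open>x \<noteq> \<mu>\<close>
      excludes.\<close>
    have "P \<noteq> {}" using cone x(2) by auto
    then obtain y c where yc: "y \<in> convex hull ((\<lambda>p. \<mu> - p) ` P)" "c \<ge> 0" "\<mu> - x = c *\<^sub>R y"
      using cone by (auto simp: convex_cone_hull_convex_hull_nonempty)
    have c: "c > 0" using yc x(2) by (cases "c = 0") auto
    define p where "p = \<mu> - y"
    have "(\<lambda>p. \<mu> - p) ` P = (+) \<mu> ` uminus ` P" by (auto simp: image_image)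
    then have "convex hull ((\<lambda>p. \<mu> - p) ` P) = (+) \<mu> ` uminus ` (convex hull P)"
      by (metis convex_hull_translation convex_hull_linear_image linear_uminus)
    then have pP: "p \<in> convex hull P" using yc(1) by (auto simp: p_def)
    then have pH: "p \<in> ?H" using hull_minimal[of P ?H convex] PH conv by blast
    have x_eq: "x = \<mu> + c *\<^sub>R (p - \<mu>)" using yc(3) by (simp add: p_def algebra_simps)
    \<comment> \<open>If \<open>p\<close> lies beyond \<open>x\<close>, then \<open>x\<close> is
      interior to the segment from \<open>\<mu>\<close> to \<open>p\<close> and the face property
      applies; otherwise \<open>p\<close> lies on the segment from \<open>\<mu>\<close> to
      \<open>x\<close> and convexity suffices.\<close>
    have "p \<in> E"
    proof (cases "c < 1")
      case True
      have "x = (1 - c) *\<^sub>R \<mu> + c *\<^sub>R p" by (simp add: x_eq algebra_simps)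
      moreover have "\<mu> \<noteq> p" using x_eq x(2) by auto
      ultimately have "x \<in> open_segment \<mu> p" unfolding in_segment using c True by blast
      moreover have "\<mu> \<in> ?H" using act_in_orbit_hull[of "[]"] by simp
      ultimately show ?thesis using face_ofD[OF face _ _ pH x(1)] by blast
    next
      case False
      then have "p = (1 - 1 / c) *\<^sub>R \<mu> + (1 / c) *\<^sub>R x" using c by (simp add: x_eq algebra_simps)
      then have "p \<in> closed_segment \<mu> x" unfolding in_segment using False by (intro exI[of _ "1 / c"]) auto
      moreover have "convex E" using face by (rule face_of_imp_convex)
      ultimately show ?thesis using x(1) E(2) unfolding convex_contains_segment by blast
    qed
    then show ?thesis using face_meets_hull_generators[OF face conv PH pP] by blast
  qed
  let ?Es = "{E. edge_in E ?H \<and> \<mu> \<in> E}"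
  define f where "f E = (SOME p. p \<in> P \<and> p \<in> E)" for E
  have f: "f E \<in> P \<and> f E \<in> E" if "E \<in> ?Es" for E
    unfolding f_def by (rule someI_ex) (use meets that in blast)
  have "inj_on f ?Es"
  proof (rule inj_onI)
    fix E E' assume EE: "E \<in> ?Es" "E' \<in> ?Es" and eq: "f E = f E'"
    have "f E \<in> P" "f E \<in> E" "f E \<in> E'"
      using f[OF EE(1)] f[OF EE(2)] unfolding eq[symmetric] by auto
    then have mem: "\<mu> \<in> E \<inter> E'" "f E \<in> E \<inter> E'" and ne: "\<mu> \<noteq> f E"
      using EE P_ne by auto
    have edges: "edge_in E ?H" "edge_in E' ?H" using EE by auto
    show "E = E'"
    proof (rule subset_antisym)
      show "E' \<subseteq> E" by (rule edge_in_subset[OF edges mem ne])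
      show "E \<subseteq> E'"
        by (rule edge_in_subset[OF edges(2,1) mem[unfolded Int_commute[of E]] ne])
    qed
  qed
  moreover have "f ` ?Es \<subseteq> P" using f by blast
  ultimately show ?thesis using finP by (rule inj_on_finite)
qed

end

theorem corollary3p19:
  fixes A :: "real^'n^'n"
    and \<alpha> :: "'n \<Rightarrow> ('h::euclidean_space) \<Rightarrow>\<^sub>L real" and \<alpha>v :: "'n \<Rightarrow> 'h"
    and \<mu> :: "'h \<Rightarrow>\<^sub>L real"
  assumes "gen_cartan A" and "realization A \<alpha> \<alpha>v" and "\<mu> \<in> fund_chamber \<alpha>v"
  shows "(finite_part A (Pi_star A (J0 \<alpha>v \<mu>) \<inter> J0 \<alpha>v \<mu>) = Pi_star A (J0 \<alpha>v \<mu>) \<inter> J0 \<alpha>v \<mu>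
            \<longleftrightarrow> finite {E. edge_in E (orbit_hull \<alpha> \<alpha>v \<mu>) \<and> \<mu> \<in> E}) \<and>
         (finite_type A UNIV \<or> affine_type A UNIV \<or> strongly_hyperbolic A
            \<longrightarrow> finite {E. edge_in E (orbit_hull \<alpha> \<alpha>v \<mu>) \<and> \<mu> \<in> E})"
proof -
  have re: "inj \<alpha>" "independent (range \<alpha>)" "inj \<alpha>v" "independent (range \<alpha>v)"
    "\<And>i j. blinfun_apply (\<alpha> j) (\<alpha>v i) = A $ i $ j"
    using assms(2) by (auto simp: realization_def)
  obtain e where e: "\<And>i j. blinfun_apply (\<alpha> j) (e i) = (if i = j then 1 else 0)"
    using dual_vector_exists[OF re(1,2)] by metis
  obtain \<rho> :: "'h \<Rightarrow>\<^sub>L real" where \<rho>: "\<And>i. \<rho> (\<alpha>v i) = 1"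
    using weight_exists[OF re(3,4)] by metis
  interpret cartan_data A \<alpha> \<alpha>v e
    by unfold_locales (use assms(1) re(5) e in auto)
  let ?fin = "finite {E. edge_in E (orbit_hull \<alpha> \<alpha>v \<mu>) \<and> \<mu> \<in> E}"
  let ?comps = "\<forall>C \<in> conn_comps A (Pi_star A (J0 \<alpha>v \<mu>) \<inter> J0 \<alpha>v \<mu>). finite_type A C"
  have "?comps \<Longrightarrow> ?fin" using finite_edges_if_finite_type[OF assms(3) \<rho>] by blast
  moreover have "?fin \<Longrightarrow> ?comps"
    using finite_type_of_finite_orbits finite_orbit_if_finite_edges[OF assms(3)] by blast
  moreover have "finite_type A UNIV \<or> affine_type A UNIV \<or> strongly_hyperbolic A \<Longrightarrow> ?comps"
    using components_finite_type by blast
  ultimately show ?thesis unfolding finite_part_eq_iff by blast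
qed

end
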